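(* Let $m,n,\ell\in\mathbb{N}$ be such that $n\leq\sqrt[4]{m\ell}$, and assume that $m\ell-n^4$ is not of the form $4^r(8s+7)$ for any $r,s\in\mathbb{N}$. Then there exist $a,b,c,d\in\mathbb{N}$ with $a^2+b^2+c^2+d^2=\ell$ such that the system $$\begin{cases} m = x^2+y^2+z^2+t^2\\ n^2 = ax+by+cz+dt\end{cases}$$ has a solution $(x,y,z,t)\in\mathbb{Z}^4$.
   Context: Here $\mathbb{N}=\{0,1,2,\ldots\}$. *)

theory Defs
  imports Complex_Main
begin

end

theory Submission
  imports Defs "HOL-Number_Theory.Number_Theory" "HOL-Computational_Algebra.Squarefree"
begin

text \<open>
  By Euler's four-square identity the system says that the quaternion with real part \<open>n\<^sup>2\<close> and
  suitable imaginary part, of norm \<open>m l\<close>, factors into integral quaternions of norms \<open>l\<close> and \<open>m\<close>.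
  Legendre's three-square theorem supplies the imaginary part, and every integral quaternion
  factors this way by a Euclidean descent that reduces it modulo \<open>l\<close> and swaps the two norms.

  For the three-square theorem take \<open>n\<close> squarefree. If \<open>Q\<close> is a sum of two rational squares, \<open>-Q\<close> a
  square modulo \<open>n\<close> and \<open>n\<close> a square modulo \<open>Q\<close>, then the pigeonhole principle solves
  \<open>n w\<^sup>2 = z\<^sup>2 + Q t\<^sup>2\<close>, so \<open>n\<close> is a sum of three rational squares, hence of three integral ones by
  Davenport--Cassels descent. By quadratic reciprocity a prime \<open>q \<equiv> 1 (mod 4)\<close> with prescribed
  Legendre symbols modulo the primes dividing \<open>2 n\<close> gives such a \<open>Q \<in> {q, 2 q}\<close>. To find \<open>q\<close>,
  only \<open>L(1, \<chi>) \<noteq> 0\<close> for real characters is needed, so Dirichlet's theorem is not used in full.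
\<close>

section \<open>Mertens-type sums over prime powers\<close>

text \<open>Summation by parts pairs the partial sums of \<open>c\<close> with the decrements of
  \<open>f\<close>, which are nonnegative and telescope; this leaves
  \<open>B * f N + B * (f M - f N)\<close>.\<close>

lemma abel_summation_bound:
  fixes c f :: "nat \<Rightarrow> real"
  assumes partial: "\<And>j. \<bar>\<Sum>n=M..<j. c n\<bar> \<le> B"
    and decr: "\<And>n. M \<le> n \<Longrightarrow> f (Suc n) \<le> f n" and nonneg: "\<And>n. M \<le> n \<Longrightarrow> 0 \<le> f n"
  shows "\<bar>\<Sum>n=M..<N. c n * f n\<bar> \<le> B * f M"
proof (cases "M \<le> N")
  case True
  have "(\<Sum>n=M..<N. c n * f n) = (\<Sum>n=M..<N. c n) * f N
      + (\<Sum>n=M..<N. (\<Sum>k=M..<Suc n. c k) * (f n - f (Suc n)))"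
    using True by (induction N rule: dec_induct) (auto simp: algebra_simps)
  also have "\<bar>\<dots>\<bar> \<le> B * f N + (\<Sum>n=M..<N. B * (f n - f (Suc n)))"
  proof (intro order.trans[OF abs_triangle_ineq] add_mono order.trans[OF sum_abs] sum_mono)
    show "\<bar>(\<Sum>n=M..<N. c n) * f N\<bar> \<le> B * f N"
      using partial[of N] nonneg[OF True] by (simp add: abs_mult mult_right_mono)
    fix n assume "n \<in> {M..<N}"
    then show "\<bar>(\<Sum>k=M..<Suc n. c k) * (f n - f (Suc n))\<bar> \<le> B * (f n - f (Suc n))"
      unfolding abs_mult using partial[of "Suc n"] decr[of n] by (intro mult_mono) auto
  qed
  also have "(\<Sum>n=M..<N. B * (f n - f (Suc n))) = B * (f M - f N)"
    using sum_Suc_diff'[OF True, of "\<lambda>n. - f n"] by (simp flip: sum_distrib_left)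
  finally show ?thesis by (simp add: algebra_simps)
next
  case False
  then show ?thesis
    using partial[of M] nonneg[of M] by (auto intro: mult_nonneg_nonneg)
qed

text \<open>Both sides sum over the pairs \<open>(d, m)\<close> with \<open>d m \<le> N\<close>.\<close>
lemma sum_divisor_pairs:
  fixes g :: "nat \<Rightarrow> nat \<Rightarrow> real"
  shows "(\<Sum>n=1..N. \<Sum>d | d dvd n. g d (n div d)) = (\<Sum>d=1..N. \<Sum>m=1..N div d. g d m)"
proof -
  have "(\<Sum>n=1..N. \<Sum>d | d dvd n. g d (n div d))
      = (\<Sum>(n,d)\<in>Sigma {1..N} (\<lambda>n. {d. d dvd n}). g d (n div d))"
    by (rule sum.Sigma) auto
  also have "\<dots> = (\<Sum>(d,m)\<in>Sigma {1..N} (\<lambda>d. {1..N div d}). g d m)"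
  proof (rule sum.reindex_bij_witness[where i = "\<lambda>(d,m). (d * m, d)" and j = "\<lambda>(n,d). (d, n div d)"], goal_cases)
    case (1 a)
    then show ?case by auto
  next
    case (2 a)
    then obtain n d where a: "a = (n, d)" "1 \<le> n" "n \<le> N" "d dvd n" by auto
    then have "1 \<le> d" "d \<le> N" using dvd_imp_le[of d n] by (auto simp: Suc_le_eq intro: Nat.gr0I)
    moreover have "1 \<le> n div d" using a by (auto elim!: dvdE)
    ultimately show ?case using a by (auto simp: div_le_mono)
  next
    case (3 a)
    then show ?case by auto
  next
    case (4 a)
    then obtain d m where a: "a = (d, m)" "1 \<le> d" "d \<le> N" "1 \<le> m" "m \<le> N div d" by auto
    then have "d * m \<le> N" using times_div_less_eq_dividend[of d N] by (meson le_trans mult_le_mono2)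
    then show ?case using a by auto
  qed auto
  also have "\<dots> = (\<Sum>d=1..N. \<Sum>m=1..N div d. g d m)"
    by (rule sum.Sigma[symmetric]) auto
  finally show ?thesis .
qed

abbreviation \<Lambda> :: "nat \<Rightarrow> real" where "\<Lambda> \<equiv> mangoldt"

text \<open>\<open>ln\<close> is the divisor sum of \<open>\<Lambda>\<close>, and
  \<open>h n = h d * h (n div d)\<close> separates the two factors of a divisor pair. Used for
  \<open>h = 1\<close>, for \<open>\<chi> n / n\<close> and for the indicator of coprimality to
  \<open>K\<close>.\<close>

lemma sum_multiplicative_ln:
  fixes h :: "nat \<Rightarrow> real"
  assumes mult: "\<And>a b. h (a * b) = h a * h b"
  shows "(\<Sum>n=1..N. h n * ln n) = (\<Sum>d=1..N. h d * \<Lambda> d * (\<Sum>m=1..N div d. h m))"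
proof -
  have "(\<Sum>n=1..N. h n * ln n) = (\<Sum>n=1..N. \<Sum>d | d dvd n. h d * \<Lambda> d * h (n div d))"
  proof (rule sum.cong[OF refl])
    fix n :: nat assume n: "n \<in> {1..N}"
    have "h n * ln n = (\<Sum>d | d dvd n. h n * \<Lambda> d)"
      using n mangoldt_sum[of n, where ?'a = real] by (simp flip: sum_distrib_left)
    also have "\<dots> = (\<Sum>d | d dvd n. h d * \<Lambda> d * h (n div d))"
      by (intro sum.cong refl) (metis (no_types, lifting) dvd_mult_div_cancel mem_Collect_eq mult mult.assoc mult.commute)
    finally show "h n * ln n = (\<Sum>d | d dvd n. h d * \<Lambda> d * h (n div d))" .
  qed
  then show ?thesis using sum_divisor_pairs[of "\<lambda>d m. h d * \<Lambda> d * h m" N]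
    by (simp add: sum_distrib_left)
qed

section \<open>Chebyshev's upper bound\<close>

lemma ln_fact_mangoldt: "ln (fact N) = (\<Sum>d=1..N. \<Lambda> d * real (N div d))"
proof -
  have "ln (fact N) = (\<Sum>n=1..N. ln (real n))"
    by (induction N) (auto simp: ln_mult)
  then show ?thesis using sum_multiplicative_ln[of "\<lambda>_. 1" N] by simp
qed

text \<open>Chebyshev's argument: the logarithm of the central binomial coefficient weights
  \<open>\<Lambda> d\<close> by \<open>2*n div d - 2 * (n div d)\<close>, which is never negative
  and equals 1 for \<open>n < d \<le> 2*n\<close>.\<close>

lemma sum_mangoldt_double: "(\<Sum>d=1..2*n. \<Lambda> d) \<le> (\<Sum>d=1..n. \<Lambda> d) + 2 * real n"
proof -
  have "ln (fact (2*n) / (fact n * fact n) :: real) \<le> ln (2 ^ (2*n))"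
  proof -
    have "fact (2*n) / (fact n * fact n) = real ((2*n) choose n)"
      by (simp add: binomial_fact)
    also have "\<dots> \<le> 2 ^ (2*n)" 
      by (metis binomial_le_pow2 of_nat_le_iff of_nat_numeral of_nat_power)
    finally show ?thesis by (subst ln_le_cancel_iff) auto
  qed
  also have "\<dots> = 2 * n * ln 2" by (simp add: ln_realpow)
  also have "\<dots> \<le> real (2 * n) * 1" using ln_2_less_1 by (intro mult_left_mono) auto
  finally have ub: "ln (fact (2*n)) - 2 * ln (fact n) \<le> 2 * real n"
    by (simp add: ln_div ln_mult)
  have ext: "ln (fact n) = (\<Sum>d=1..2*n. \<Lambda> d * real (n div d))"
    unfolding ln_fact_mangoldt by (rule sum.mono_neutral_left) auto
  have "(\<Sum>d=1..2*n. \<Lambda> d) - (\<Sum>d=1..n. \<Lambda> d) = (\<Sum>d=n+1..2*n. \<Lambda> d)"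
    using sum.ub_add_nat[of 1 n \<Lambda> n] by (simp add: mult_2)
  also have "\<dots> = (\<Sum>d=n+1..2*n. \<Lambda> d * (real (2*n div d) - 2 * real (n div d)))"
  proof (rule sum.cong[OF refl])
    fix d assume d: "d \<in> {n+1..2*n}"
    then have "2*n div d = 1" by (intro div_nat_eqI) auto
    then show "\<Lambda> d = \<Lambda> d * (real (2*n div d) - 2 * real (n div d))" using d by simp
  qed
  also have "\<dots> \<le> (\<Sum>d=1..2*n. \<Lambda> d * (real (2*n div d) - 2 * real (n div d)))"
  proof (rule sum_mono2)
    fix d :: nat
    have "2 * (n div d) \<le> 2*n div d"
      using div_times_less_eq_dividend[of n d] by (cases "d = 0") (simp_all add: less_eq_div_iff_mult_less_eq)
    then show "0 \<le> \<Lambda> d * (real (2*n div d) - 2 * real (n div d))"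
      by (intro mult_nonneg_nonneg mangoldt_nonneg) linarith
  qed auto
  also have "\<dots> = ln (fact (2*n)) - 2 * ln (fact n)"
    unfolding ext ln_fact_mangoldt[of "2*n"] by (simp add: algebra_simps sum_subtractf sum_distrib_left)
  finally show ?thesis using ub by linarith
qed

lemma mangoldt_le: "n > 0 \<Longrightarrow> \<Lambda> n \<le> ln n"
  using mangoldt_sum[of n, where ?'a = real] member_le_sum[of n "{d. d dvd n}" \<Lambda>] mangoldt_nonneg by auto

lemma chebyshev_upper: "(\<Sum>d=1..N. \<Lambda> d) \<le> 4 * real N"
proof (induction N rule: less_induct)
  case (less N)
  show ?case
  proof (cases "N = 0")
    case False
    define n where "n = N div 2"
    have IH: "(\<Sum>d=1..n. \<Lambda> d) \<le> 4 * real n" using less False by (simp add: n_def)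
    then have two: "(\<Sum>d=1..2*n. \<Lambda> d) \<le> 6 * real n" using sum_mangoldt_double[of n] by linarith
    consider "N = 2*n" | "N = 2*n+1" unfolding n_def by linarith
    then show ?thesis
    proof cases
      case 2
      \<comment> \<open>The extra term raises the bound \<open>6 * n\<close> to
        \<open>8 * n\<close>, which still fits under \<open>4 * N\<close>.\<close>
      have "\<Lambda> (2*n+1) \<le> ln (real (2*n+1))" using mangoldt_le[of "2*n+1"] by simp
      also have "\<dots> \<le> 2 * real n" using ln_add_one_self_le_self[of "2 * real n"] by (simp add: add.commute)
      finally show ?thesis using two 2 by simp
    qed (use two in auto)
  qed auto
qed

section \<open>Real characters\<close>

lemma geometric_sum_Suc_shift:
  fixes x :: real
  shows "(\<Sum>i<Suc m. x^i) = 1 + x * (\<Sum>i<m. x^i)"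
  unfolding sum.lessThan_Suc_shift by (simp add: sum_distrib_left)

text \<open>The middle power is at most the average of all \<open>2*k+1\<close> powers. The
  induction step adds the outer pair 1 and \<open>x^(2*k+2)\<close>, whose sum is at least
  \<open>2 * x^(k+1)\<close>.\<close>

lemma odd_geometric_sum_ge:
  fixes x :: real assumes "0 \<le> x"
  shows "real (2*k+1) * x^k \<le> (\<Sum>i<2*k+1. x^i)"
proof (induction k)
  case (Suc k)
  have "(\<Sum>i<2*Suc k+1. x^i) = 1 + x * (\<Sum>i<2*k+1. x^i) + (x^Suc k)\<^sup>2"
  proof -
    have "2*Suc k+1 = Suc (Suc (2*k+1))" "(x^Suc k)\<^sup>2 = x^Suc (2*k+1)"
      by (simp_all add: power2_eq_square flip: power_add mult_2)
    then show ?thesis using geometric_sum_Suc_shift[of x "2*k+1"] by (simp only: sum.lessThan_Suc)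
  qed
  moreover have "x * (real (2*k+1) * x^k) \<le> x * (\<Sum>i<2*k+1. x^i)"
    using Suc assms by (rule mult_left_mono)
  moreover have "0 \<le> (1 - x^Suc k)\<^sup>2" by simp
  ultimately show ?case by (simp add: power2_eq_square algebra_simps)
qed simp

text \<open>Passing from \<open>n\<close> to \<open>n+1\<close> multiplies the product by
  \<open>x\<close> and adds \<open>?h * (1 + x^(n+1))\<close>, the sum of the first
  \<open>2*n+2\<close> powers, to which \<open>odd_geometric_sum_ge\<close> applies.\<close>

lemma geometric_sum_product_ge:
  fixes x :: real assumes x: "0 \<le> x" "x \<le> 1"
  shows "real n * real (n+1) * x^n \<le> (\<Sum>i<n. x^i) * (\<Sum>i<n+1. x^i)"
proof (induction n)
  case (Suc n)
  let ?g = "\<Sum>i<n. x^i" and ?h = "\<Sum>i<n+1. x^i"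
  have h: "?h = 1 + x * ?g" using geometric_sum_Suc_shift[of x n] by simp
  have split: "(\<Sum>i<n+1+m. x^i) = ?h + x^(n+1) * (\<Sum>i<m. x^i)" for m
    by (induction m) (auto simp: algebra_simps power_add)
  have "x^(n+1) * (2 * real n + 2) \<le> 1 + x * (real (2*n+1) * x^n)"
    using power_le_one[OF x, of "Suc n"] by (simp add: algebra_simps)
  also have "\<dots> \<le> 1 + x * (\<Sum>i<2*n+1. x^i)"
    using odd_geometric_sum_ge[OF x(1), of n] x by (intro add_left_mono mult_left_mono) auto
  also have "\<dots> = (\<Sum>i<n+1+(n+1). x^i)"
  proof -
    have "n+1+(n+1) = Suc (2*n+1)" by simp
    then show ?thesis using geometric_sum_Suc_shift[of x "2*n+1"] by (simp only:)
  qed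
  also have "\<dots> = ?h * (1 + x^(n+1))" unfolding split by (simp add: algebra_simps)
  finally have *: "x^(n+1) * (2 * real n + 2) \<le> ?h * (1 + x^(n+1))" .
  have "?h * (\<Sum>i<Suc n+1. x^i) = x * (?g * ?h) + ?h * (1 + x^(n+1))"
    using h by (simp add: algebra_simps)
  moreover have "x * (real n * real (n+1) * x^n) \<le> x * (?g * ?h)"
    using Suc x(1) by (rule mult_left_mono)
  ultimately show ?case using * by (simp add: algebra_simps)
qed simp

text \<open>The weights \<open>x^n / (1 - x^n)\<close> blow up as \<open>x\<close> tends to 1. Their
  differences from \<open>1 / (n * (1 - x))\<close> still decrease and start at
  \<open>b 1 = 1\<close> for every \<open>x\<close>, so Abel summation gives a bound uniform in
  \<open>x\<close>.\<close>

lemma lambert_difference_antimono: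
  fixes x :: real assumes x: "0 < x" "x < 1" and n: "1 \<le> n"
  defines "b \<equiv> \<lambda>n. 1 / (real n * (1 - x)) - x^n / (1 - x^n)"
  shows "b (Suc n) \<le> b n" "0 \<le> b n"
proof -
  let ?g = "\<lambda>n. \<Sum>i<n. x^i"
  have g: "1 - x^m = (1 - x) * ?g m" for m using one_diff_power_eq[of x m] .
  have pos: "?g m > 0" if "1 \<le> m" for m using x that by (intro sum_pos) (auto simp: lessThan_empty_iff)
  have "x^n / (1 - x^n) - x^Suc n / (1 - x^Suc n) = x^n / ((1 - x) * (?g n * ?g (Suc n)))"
  proof -
    have "x^n * (1 - x^Suc n) - x^Suc n * (1 - x^n) = x^n * (1 - x)" by (simp add: algebra_simps)
    moreover have nz: "1 - x^n \<noteq> 0" "1 - x^Suc n \<noteq> 0"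
      using pos[of n] pos[of "Suc n"] x n unfolding g by auto
    ultimately have "x^n / (1 - x^n) - x^Suc n / (1 - x^Suc n) = x^n * (1 - x) / ((1 - x^n) * (1 - x^Suc n))"
      using nz by (simp add: diff_frac_eq mult.commute del: power_Suc)
    also have "\<dots> = x^n / ((1 - x) * (?g n * ?g (Suc n)))"
      using x unfolding g by simp
    finally show ?thesis .
  qed
  also have "\<dots> \<le> 1 / ((1 - x) * (real n * real (Suc n)))"
    using geometric_sum_product_ge[of x n] pos[of n] pos[of "Suc n"] x n
    by (simp add: divide_simps) (simp add: algebra_simps)
  also have "\<dots> = 1 / (real n * (1 - x)) - 1 / (real (Suc n) * (1 - x))"
    proof -
    have "1 / real n - 1 / real (Suc n) = 1 / (real n * real (Suc n))" using n by (simp add: field_simps)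
    then show ?thesis by (metis (no_types, lifting) diff_divide_distrib divide_divide_eq_left mult.commute)
  qed
  finally show "b (Suc n) \<le> b n" by (simp add: b_def)
  have "(\<Sum>i<n. x^n) \<le> ?g n" using x by (intro sum_mono power_decreasing) auto
  then show "0 \<le> b n" using pos[OF n] x n by (simp add: b_def g divide_simps mult.commute)
qed

section \<open>Divisor sums of a real character\<close>

lemma bij_betw_divisors_prime_power_mult:
  fixes p :: nat
  assumes "prime p" "\<not> p dvd m" "m > 0"
  shows "bij_betw (\<lambda>(i,d). p^i * d) ({..k} \<times> {d. d dvd m}) {d. d dvd p^k * m}"
proof (rule bij_betw_imageI)
  show "inj_on (\<lambda>(i,d). p^i * d) ({..k} \<times> {d. d dvd m})"
  proof (rule inj_onI, clarify)
    fix i d j e assume h: "d dvd m" "e dvd m" "p^i * d = p^j * e"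
    have nd: "\<not> p dvd d" "\<not> p dvd e" using h assms dvd_trans by blast+
    have "multiplicity p (p^i * d) = i" "multiplicity p (p^j * e) = j"
      using assms nd by (auto intro!: multiplicity_eqI dest: dvd_mult_cancel1 simp: prime_gt_0_nat)
    then show "i = j \<and> d = e" using h assms by (auto simp: prime_gt_0_nat)
  qed
  show "(\<lambda>(i,d). p^i * d) ` ({..k} \<times> {d. d dvd m}) = {d. d dvd p^k * m}"
  proof (intro equalityI subsetI)
    fix c assume "c \<in> {d. d dvd p^k * m}"
    then obtain a d where "c = a * d" "a dvd p^k" "d dvd m" using division_decomp by blast
    moreover from this obtain i where "i \<le> k" "a = p^i" using assms(1) divides_primepow_nat by blast
    ultimately show "c \<in> (\<lambda>(i,d). p^i * d) ` ({..k} \<times> {d. d dvd m})" by auto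
  qed (auto intro!: mult_dvd_mono le_imp_power_dvd)
qed

locale real_character =
  fixes K :: nat and \<chi> :: "nat \<Rightarrow> real"
  assumes K_pos: "K > 0"
    and mult: "\<chi> (a * b) = \<chi> a * \<chi> b"
    and periodic: "\<chi> (a + K) = \<chi> a"
    and range: "\<chi> a \<in> {-1, 0, 1}"
    and eq_0_iff: "\<chi> a = 0 \<longleftrightarrow> \<not> coprime a K"
begin

lemma chi_1 [simp]: "\<chi> (Suc 0) = 1"
  using mult[of 1 1] eq_0_iff[of 1] by auto

lemma chi_power: "\<chi> (a ^ k) = \<chi> a ^ k"
  by (induction k) (auto simp: mult)

lemma chi_mod: "\<chi> (a mod K) = \<chi> a"
proof -
  have "\<chi> (a + K * k) = \<chi> a" for a k
  proof (induction k)
    case (Suc k)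
    then show ?case using periodic[of "a + K * k"] by (simp add: algebra_simps)
  qed simp
  from this[of "a mod K" "a div K"] show ?thesis by simp
qed

lemma abs_chi_le: "\<bar>\<chi> a\<bar> \<le> 1"
  using range[of a] by auto

text \<open>The Dirichlet convolution of \<open>\<chi>\<close> with 1; its power series is the
  Lambert series of \<open>\<chi>\<close>.\<close>

definition r :: "nat \<Rightarrow> real" where "r n = (\<Sum>d | d dvd n. \<chi> d)"

lemma r_prime_power_mult:
  assumes "prime p" "\<not> p dvd m" "m > 0"
  shows "r (p^k * m) = (\<Sum>i\<le>k. \<chi> p ^ i) * r m"
  unfolding r_def sum_product sum.cartesian_product
  by (rule sum.reindex_bij_betw[OF bij_betw_divisors_prime_power_mult[OF assms], symmetric, THEN trans])
     (auto intro!: sum.cong simp: mult chi_power)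

lemma geometric_sum_chi: "0 \<le> (\<Sum>i\<le>k. \<chi> p ^ i)" "1 \<le> (\<Sum>i\<le>2*k. \<chi> p ^ i)"
proof -
  have a: "(\<Sum>i\<le>k. (-1::real) ^ i) = (if even k then 1 else 0)" for k
    by (induction k) auto
  have b: "(\<Sum>i\<le>k. (0::real) ^ i) = 1" for k
    by (induction k) auto
  show "0 \<le> (\<Sum>i\<le>k. \<chi> p ^ i)" "1 \<le> (\<Sum>i\<le>2*k. \<chi> p ^ i)"
    using range[of p] a[of k] a[of "2*k"] b[of k] b[of "2*k"] by auto
qed

text \<open>Splitting off a full prime power reduces both claims to the geometric sums
  \<open>1 + \<chi> p + ... + \<chi> p ^ k\<close>, which are nonnegative, and at least 1 for even
  \<open>k\<close>.\<close>

lemma r_nonneg_and_square: "n > 0 \<Longrightarrow> 0 \<le> r n \<and> 1 \<le> r (n\<^sup>2)"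
proof (induction n rule: less_induct)
  case (less n)
  show ?case
  proof (cases "n = 1")
    case True
    then show ?thesis by (simp add: r_def)
  next
    case False
    then obtain p where p: "prime p" "p dvd n" using prime_factor_nat by blast
    obtain m where m: "n = p ^ multiplicity p n * m" "\<not> p dvd m"
      using multiplicity_decompose'[of n p] less.prems p by (metis not_prime_unit not_gr_zero)
    define k where "k = multiplicity p n"
    have "k > 0" using p less.prems by (simp add: k_def prime_multiplicity_gt_zero_iff)
    then have "1 < p^k" using p one_less_power prime_gt_1_nat by blast
    moreover have "m > 0" using m less.prems by (auto intro: Nat.gr0I)
    ultimately have IH: "0 \<le> r m" "1 \<le> r (m\<^sup>2)" using less.IH[of m] m by (auto simp flip: k_def)
    have "r n = (\<Sum>i\<le>k. \<chi> p ^ i) * r m"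
      using r_prime_power_mult[of p m k] m p \<open>m > 0\<close> by (simp flip: k_def)
    moreover have "r (n\<^sup>2) = (\<Sum>i\<le>2*k. \<chi> p ^ i) * r (m\<^sup>2)"
    proof -
      have "n\<^sup>2 = p ^ (2*k) * m\<^sup>2" using m(1) by (metis k_def mult.commute power_mult power_mult_distrib)
      then show ?thesis using r_prime_power_mult[of p "m\<^sup>2" "2*k"] m p \<open>m > 0\<close>
        by (simp add: prime_dvd_power_iff)
    qed
    ultimately show ?thesis using IH geometric_sum_chi[where p = p]
      by (auto intro!: mult_nonneg_nonneg) (metis mult_mono' mult_1 zero_le_one)
  qed
qed

end

section \<open>Nonvanishing of the L-value at 1 and its consequence for prime powers\<close>

locale nonprincipal_real_character = real_character +
  assumes nonprincipal: "\<exists>a. \<chi> a = -1"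
begin

text \<open>Multiplication by \<open>a\<close> with \<open>\<chi> a = -1\<close> permutes the
  residues modulo \<open>K\<close> and negates the sum.\<close>

lemma sum_period: "(\<Sum>n<K. \<chi> n) = 0"
proof -
  obtain a where a: "\<chi> a = -1" using nonprincipal by blast
  then have cop: "coprime a K" using eq_0_iff[of a] by simp
  let ?f = "\<lambda>n. a * n mod K"
  have inj: "inj_on ?f {..<K}"
  proof (rule inj_onI)
    fix x y assume "x \<in> {..<K}" "y \<in> {..<K}" "?f x = ?f y"
    then show "x = y" using cong_mult_lcancel_nat[OF cop] by (simp add: cong_def)
  qed
  moreover have "?f ` {..<K} \<subseteq> {..<K}" using K_pos by auto
  ultimately have "bij_betw ?f {..<K} {..<K}"
    by (simp add: bij_betw_def endo_inj_surj)
  then have "(\<Sum>n<K. \<chi> n) = (\<Sum>n<K. \<chi> (?f n))"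
    using sum.reindex_bij_betw[of ?f "{..<K}" "{..<K}" \<chi>] by simp
  also have "\<dots> = - (\<Sum>n<K. \<chi> n)" by (simp add: chi_mod mult a sum_negf)
  finally show ?thesis by simp
qed

lemma partial_sum_bound: "\<bar>\<Sum>n<N. \<chi> n\<bar> \<le> K"
proof (induction N rule: less_induct)
  case (less N)
  show ?case
  proof (cases "N < K")
    case True
    have "\<bar>\<Sum>n<N. \<chi> n\<bar> \<le> (\<Sum>n<N. 1)" by (rule order.trans[OF sum_abs]) (intro sum_mono abs_chi_le)
    then show ?thesis using True by simp
  next
    case False
    have "(\<Sum>n<K + j. \<chi> n) = (\<Sum>n<j. \<chi> n)" for j
      by (induction j) (auto simp: sum_period periodic add.commute)
    from this[of "N - K"] show ?thesis using False less[of "N - K"] K_pos by simp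
  qed
qed

lemma interval_sum_bound: "\<bar>\<Sum>n=M..<N. \<chi> n\<bar> \<le> 2 * K"
proof (cases "M \<le> N")
  case True
  then have "(\<Sum>n=M..<N. \<chi> n) = (\<Sum>n<N. \<chi> n) - (\<Sum>n<M. \<chi> n)"
    by (simp add: sum_diff_nat_ivl lessThan_atLeast0)
  then show ?thesis using partial_sum_bound[of N] partial_sum_bound[of M] by linarith
qed auto

lemma weighted_sum_bound:
  fixes f :: "nat \<Rightarrow> real"
  assumes "\<And>n. M \<le> n \<Longrightarrow> f (Suc n) \<le> f n" "\<And>n. M \<le> n \<Longrightarrow> 0 \<le> f n"
  shows "\<bar>\<Sum>n=M..N. \<chi> n * f n\<bar> \<le> 2 * K * f M"
  using abel_summation_bound[where c = \<chi> and f = f and M = M and B = "2 * K" and N = "Suc N"]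
    interval_sum_bound assms
  by (simp add: atLeastLessThanSuc_atLeastAtMost)

definition S :: "nat \<Rightarrow> real" where "S N = (\<Sum>n=1..N. \<chi> n / n)"

lemma S_diff_bound: "M \<le> N \<Longrightarrow> \<bar>S N - S M\<bar> \<le> 2 * K / (real M + 1)"
proof -
  assume "M \<le> N"
  then have "S N - S M = (\<Sum>n=Suc M..N. \<chi> n * (1 / n))"
    using sum.ub_add_nat[of 1 M "\<lambda>n. \<chi> n / n" "N - M"] by (simp add: S_def)
  also have "\<bar>\<dots>\<bar> \<le> 2 * K * (1 / Suc M)"
    by (rule weighted_sum_bound) (auto simp: field_simps)
  finally show ?thesis by (simp add: add.commute)
qed

text \<open>The value at 1 of the Dirichlet L-function of \<open>\<chi>\<close>.\<close>

definition L :: real where "L = lim S"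

lemma S_tendsto: "S \<longlonglongrightarrow> L"
proof -
  have "Cauchy S"
  proof (rule metric_CauchyI)
    fix e :: real assume "e > 0"
    obtain M :: nat where M: "2 * K / e < real M" using reals_Archimedean2 by blast
    have "dist (S m) (S n) < e" if "m \<ge> 2 * M" "n \<ge> 2 * M" for m n
    proof -
      have "2 * K / (real (2*M) + 1) < e / 2" using M \<open>e > 0\<close> by (simp add: field_simps)
      then show ?thesis
        using S_diff_bound[OF that(1)] S_diff_bound[OF that(2)] unfolding dist_real_def by linarith
    qed
    then show "\<exists>M. \<forall>m\<ge>M. \<forall>n\<ge>M. dist (S m) (S n) < e" by blast
  qed
  then show ?thesis unfolding L_def by (simp add: Cauchy_convergent_iff convergent_LIMSEQ_iff)
qed

lemma S_L_bound: "\<bar>S M - L\<bar> \<le> 2 * K / (real M + 1)"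
proof (rule LIMSEQ_le_const2)
  show "(\<lambda>N. \<bar>S M - S N\<bar>) \<longlonglongrightarrow> \<bar>S M - L\<bar>" by (intro tendsto_intros S_tendsto)
  show "\<exists>N. \<forall>n\<ge>N. \<bar>S M - S n\<bar> \<le> 2 * K / (real M + 1)"
    using S_diff_bound[of M] by (auto simp: abs_minus_commute intro!: exI[of _ M])
qed

text \<open>The left side is a truncated Lambert series. Writing \<open>x^d / (1 - x^d)\<close> as
  \<open>1 / (d * (1 - x)) - ?b d\<close> gives the main term \<open>S N / (1 - x)\<close>; the
  weights \<open>?b\<close> contribute at most \<open>2 * K\<close>, and truncation at most
  \<open>x^N / (1 - x)\<close> for each \<open>d\<close>.\<close>

lemma sum_r_power_le:
  assumes x: "0 < x" "x < 1"
  shows "(\<Sum>n=1..N. r n * x^n) \<le> S N / (1 - x) + 2 * K + N * x^N / (1 - x)"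
proof -
  let ?b = "\<lambda>n. 1 / (real n * (1 - x)) - x^n / (1 - x^n)"
  have "(\<Sum>n=1..N. r n * x^n) = (\<Sum>n=1..N. \<Sum>d | d dvd n. \<chi> d * x^(d * (n div d)))"
    by (intro sum.cong) (auto simp: r_def sum_distrib_right)
  also have "\<dots> = (\<Sum>d=1..N. \<Sum>m=1..N div d. \<chi> d * x^(d * m))"
    by (rule sum_divisor_pairs)
  also have "\<dots> \<le> (\<Sum>d=1..N. \<chi> d * (x^d / (1 - x^d)) + x^N / (1 - x))"
  proof (rule sum_mono)
    fix d assume d: "d \<in> {1..N}"
    let ?M = "N div d"
    have xd: "x^d < 1" using x d by (simp add: power_less_one_iff)
    have "(\<Sum>m=1..?M. x^(d * m)) = (\<Sum>m=1..?M. (x^d)^m)" by (simp add: power_mult)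
    also have "\<dots> = (x^d - x^(d * Suc ?M)) / (1 - x^d)"
      using xd sum_gp[of "x^d" 1 ?M] by (auto simp: power_mult power_add)
    finally have *: "(\<Sum>m=1..?M. \<chi> d * x^(d * m)) = \<chi> d * (x^d / (1 - x^d)) - \<chi> d * (x^(d * Suc ?M) / (1 - x^d))"
      unfolding sum_distrib_left[symmetric] by (simp only: diff_divide_distrib right_diff_distrib)
    have "- (\<chi> d * (x^(d * Suc ?M) / (1 - x^d))) \<le> x^(d * Suc ?M) / (1 - x^d)"
      using abs_chi_le[of d] x xd by (simp add: divide_simps) (metis abs_le_iff mult_le_cancel_right2 not_less zero_le_power less_imp_le minus_mult_left mult.commute)
    also have "\<dots> \<le> x^N / (1 - x)"
    proof (rule frac_le)
      have "N \<le> d * Suc ?M" using d dividend_less_times_div[of d N] by simp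
      then show "x^(d * Suc ?M) \<le> x^N" using x by (intro power_decreasing) auto
      show "1 - x \<le> 1 - x^d" using x d power_decreasing[of 1 d x] by simp
    qed (use x in auto)
    finally show "(\<Sum>m=1..?M. \<chi> d * x^(d * m)) \<le> \<chi> d * (x^d / (1 - x^d)) + x^N / (1 - x)"
      using * by linarith
  qed
  also have "\<dots> = S N / (1 - x) - (\<Sum>n=1..N. \<chi> n * ?b n) + N * x^N / (1 - x)"
    by (simp add: S_def sum.distrib sum_divide_distrib algebra_simps flip: sum_subtractf)
  also have "\<dots> \<le> S N / (1 - x) + 2 * K * ?b 1 + N * x^N / (1 - x)"
    using weighted_sum_bound[where M = 1 and f = ?b and N = N] lambert_difference_antimono[OF x] by (auto simp: abs_le_iff)
  also have "?b 1 = 1" using x by (simp flip: diff_divide_distrib)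
  finally show ?thesis by simp
qed

text \<open>If \<open>L\<close> vanished, the series of \<open>r n x^n\<close> would stay bounded as \<open>x\<close> tends to 1,
  but \<open>r\<close> is at least 1 on the squares.\<close>
lemma L_nonzero: "L \<noteq> 0"
proof
  assume L: "L = 0"
  \<comment> \<open>One square more than the bound \<open>2 * K\<close> allows: at
    \<open>x = 1\<close> the sum over \<open>m\<close> equals \<open>M\<close>.\<close>
  define M where "M = 2 * K + 1"
  \<comment> \<open>First \<open>N\<close> tends to infinity at fixed \<open>x\<close>, where
    \<open>L = 0\<close> removes the main term; only afterwards does \<open>x\<close> tend to
    1.\<close>
  have bound: "(\<Sum>m=1..M. x^(m\<^sup>2)) \<le> 2 * K" if x: "0 < x" "x < 1" for x :: real
  proof (rule LIMSEQ_le_const)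
    have "(\<lambda>N. S N / (1 - x) + 2 * K + N * x^N / (1 - x)) \<longlonglongrightarrow> 0 / (1 - x) + 2 * K + 0 / (1 - x)"
      using S_tendsto L x by (intro tendsto_intros) (auto intro: powser_times_n_limit_0)
    then show "(\<lambda>N. S N / (1 - x) + 2 * K + N * x^N / (1 - x)) \<longlonglongrightarrow> 2 * K" by simp
    have "(\<Sum>m=1..M. x^(m\<^sup>2)) \<le> (\<Sum>n=1..N. r n * x^n)" if "N \<ge> M\<^sup>2" for N
    proof -
      have "(\<Sum>m=1..M. x^(m\<^sup>2)) \<le> (\<Sum>m=1..M. r (m\<^sup>2) * x^(m\<^sup>2))"
        using r_nonneg_and_square x by (intro sum_mono) simp
      also have "\<dots> = (\<Sum>n\<in>(\<lambda>m. m\<^sup>2) ` {1..M}. r n * x^n)"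
        by (subst sum.reindex) (auto simp: inj_on_def)
      also have "\<dots> \<le> (\<Sum>n=1..N. r n * x^n)"
      proof (rule sum_mono2)
        have "m\<^sup>2 \<le> N" if "m \<le> M" for m using that \<open>N \<ge> M\<^sup>2\<close> power_mono[of m M 2] by linarith
        then show "(\<lambda>m. m\<^sup>2) ` {1..M} \<subseteq> {1..N}" by auto
      qed (use r_nonneg_and_square x in \<open>auto intro!: mult_nonneg_nonneg\<close>)
      finally show ?thesis .
    qed
    then show "\<exists>N0. \<forall>N\<ge>N0. (\<Sum>m=1..M. x^(m\<^sup>2)) \<le> S N / (1 - x) + 2 * K + N * x^N / (1 - x)"
      using sum_r_power_le[OF x] order.trans by blast
  qed
  have "(\<Sum>m=1..M. (1::real)^(m\<^sup>2)) \<le> 2 * K"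
  proof (rule tendsto_upperbound)
    show "((\<lambda>x. \<Sum>m=1..M. x^(m\<^sup>2)) \<longlongrightarrow> (\<Sum>m=1..M. (1::real)^(m\<^sup>2))) (at_left 1)"
      by (intro tendsto_intros)
    have "eventually (\<lambda>x. x \<in> {0<..<1}) (at_left (1::real))" by (rule eventually_at_left_real) simp
    then show "eventually (\<lambda>x. (\<Sum>m=1..M. x^(m\<^sup>2)) \<le> 2 * K) (at_left (1::real))"
      by eventually_elim (use bound in auto)
  qed simp
  then show False by (simp add: M_def)
qed

text \<open>The sum of \<open>h n * ln n\<close> is bounded by Abel summation and equals the sum of
  \<open>h d * \<Lambda> d * S (N div d)\<close>. Replacing \<open>S (N div d)\<close> by
  \<open>L\<close> costs a bounded error by Chebyshev's estimate, and \<open>L\<close> can be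
  divided out.\<close>

lemma mangoldt_sum_bounded: "\<exists>C. \<forall>N. \<bar>\<Sum>d=1..N. \<chi> d * \<Lambda> d / d\<bar> \<le> C"
proof -
  define h where "h = (\<lambda>n. \<chi> n / real n)"
  define C where "C = (2 + 2 * K + 8 * K) / \<bar>L\<bar>"
  have "\<bar>\<Sum>d=1..N. h d * \<Lambda> d\<bar> \<le> C" for N
  proof (cases "N = 0")
    case False
    have ln_sum: "\<bar>\<Sum>n=1..N. h n * ln n\<bar> \<le> 2 + 2 * K"
    proof -
      \<comment> \<open>The first two terms are split off because \<open>ln n / n\<close> is known
        to decrease only beyond \<open>exp 1\<close>.\<close>
      have "(\<Sum>n=1..N. h n * ln n) = (\<Sum>n\<in>{1..N} \<inter> {1,2}. h n * ln n) + (\<Sum>n\<in>{1..N} - {1,2}. h n * ln n)"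
        by (subst sum.Int_Diff[of _ _ "{1,2}"]) auto
      moreover have "{1..N} - {1,2} = {3..N}" by auto
      moreover have "\<bar>\<Sum>n=3..N. h n * ln n\<bar> \<le> 2 * K * (ln (real 3) / real 3)"
      proof -
        have "exp 1 \<le> (3::real)" by (rule exp_le)
        then have "ln (real (Suc n)) / real (Suc n) \<le> ln (real n) / real n" if "3 \<le> n" for n
          using that by (intro ln_x_over_x_mono) auto
        then show ?thesis
          using weighted_sum_bound[where M = 3 and f = "\<lambda>n. ln (real n) / real n" and N = N] by (simp add: h_def)
      qed
      moreover have "2 * K * (ln (real 3) / real 3) \<le> real (2 * K) * 1"
        using ln_le_minus_one[of 3] by (intro mult_left_mono) auto
      moreover have "\<bar>\<Sum>n\<in>{1..N} \<inter> {1,2}. h n * ln n\<bar> \<le> (\<Sum>n\<in>{1,2::nat}. 1)"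
      proof (rule order.trans[OF sum_abs], rule order.trans[OF sum_mono[of _ _ "\<lambda>_. 1"]])
        fix n assume "n \<in> {1..N} \<inter> {1,2::nat}"
        then have "\<bar>ln (real n)\<bar> \<le> 1" "\<bar>h n\<bar> \<le> 1"
          using ln_2_less_1 abs_chi_le[of 2] by (auto simp: h_def)
        then show "\<bar>h n * ln (real n)\<bar> \<le> 1" by (simp add: abs_mult mult_le_one)
      qed (use card_mono[of "{1,2::nat}" "{1..N} \<inter> {1,2}"] in auto)
      ultimately show ?thesis by simp
    qed
    have "L * (\<Sum>d=1..N. h d * \<Lambda> d) = (\<Sum>n=1..N. h n * ln n) - (\<Sum>d=1..N. h d * \<Lambda> d * (S (N div d) - L))"
    proof -
      have "(\<Sum>n=1..N. h n * ln n) = (\<Sum>d=1..N. h d * \<Lambda> d * S (N div d))"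
        using sum_multiplicative_ln[of h N] by (simp add: h_def mult S_def)
      then show ?thesis by (simp add: algebra_simps sum_subtractf sum_distrib_left)
    qed
    moreover have "\<bar>\<Sum>d=1..N. h d * \<Lambda> d * (S (N div d) - L)\<bar> \<le> 8 * K"
    proof -
      have "\<bar>\<Sum>d=1..N. h d * \<Lambda> d * (S (N div d) - L)\<bar> \<le> (\<Sum>d=1..N. \<Lambda> d * (2 * K / N))"
      proof (rule order.trans[OF sum_abs], rule sum_mono)
        fix d assume d: "d \<in> {1..N}"
        have "N \<le> d * (N div d + 1)" using d dividend_less_times_div[of d N] by simp
        then have "real N \<le> real d * (real (N div d) + 1)" by (metis of_nat_1 of_nat_add of_nat_le_iff of_nat_mult)
        then have "1 / real d * (2 * K / (real (N div d) + 1)) \<le> 2 * K / N"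
          using d False mult_left_mono[of "real N" "real d * (real (N div d) + 1)" "2 * K"]
          by (simp add: field_simps)
        moreover have "\<bar>h d\<bar> * \<bar>S (N div d) - L\<bar> \<le> 1 / real d * (2 * K / (real (N div d) + 1))"
          using S_L_bound[of "N div d"] abs_chi_le[of d] d by (intro mult_mono) (auto simp: h_def divide_right_mono)
        ultimately have "\<bar>h d\<bar> * \<bar>S (N div d) - L\<bar> \<le> 2 * K / N" by linarith
        from mult_left_mono[OF this mangoldt_nonneg[of d]]
        show "\<bar>h d * \<Lambda> d * (S (N div d) - L)\<bar> \<le> \<Lambda> d * (2 * K / N)"
          by (simp add: abs_mult mult_ac)
      qed
      also have "\<dots> = (\<Sum>d=1..N. \<Lambda> d) * (2 * K / N)" by (rule sum_distrib_right[symmetric])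
      also have "\<dots> \<le> (4 * real N) * (2 * K / N)" using chebyshev_upper[of N] by (intro mult_right_mono) auto
      finally show ?thesis using False by simp
    qed
    ultimately have "\<bar>L * (\<Sum>d=1..N. h d * \<Lambda> d)\<bar> \<le> 2 + 2 * K + 8 * K"
      using ln_sum by linarith
    then show ?thesis using L_nonzero by (simp add: C_def abs_mult field_simps)
  qed (simp add: C_def)
  then show ?thesis by (auto simp: h_def)
qed

end

section \<open>Primes with prescribed values of real characters\<close>

text \<open>The \<open>j\<close> numbers \<open>K * i + 1\<close> with
  \<open>j \<le> i < 2 * j\<close> are coprime to \<open>K\<close> and at most
  \<open>N = 2 * K * j\<close>. Hence the sum of \<open>ln n\<close> over \<open>n \<le> N\<close>
  coprime to \<open>K\<close> is at least \<open>j * ln j\<close>, while it is at most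
  \<open>N\<close> times the sum in question.\<close>

lemma mangoldt_sum_coprime_unbounded:
  assumes K: "K > (0::nat)"
  shows "\<exists>N. B < (\<Sum>d=1..N. (if coprime d K then 1 else 0) * \<Lambda> d / d)"
proof -
  define c :: "nat \<Rightarrow> real" where "c = (\<lambda>n. if coprime n K then 1 else 0)"
  have c_mult: "c (a * b) = c a * c b" for a b by (simp add: c_def)
  obtain j :: nat where j: "exp (2 * K * \<bar>B\<bar> + 1) < real j" using reals_Archimedean2 by blast
  then have j1: "1 < real j" using one_le_exp_iff[of "2 * K * \<bar>B\<bar> + 1"] by (smt (verit) mult_nonneg_nonneg of_nat_0_le_iff abs_ge_zero)
  have lnj: "2 * K * \<bar>B\<bar> < ln j" using j j1 ln_less_cancel_iff[of "exp (2 * K * \<bar>B\<bar> + 1)" j] by simp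
  define N where "N = 2 * K * j"
  have N: "N > 0" using K j1 by (simp add: N_def)
  have cop: "coprime (Suc (K * i)) K" for i
    by (metis Suc_eq_plus1 coprime_1_left coprime_iff_gcd_eq_1 gcd.commute gcd_add_mult mult.commute add.commute)
  have "real j * ln j = (\<Sum>i=j..<2*j. ln (real j))" by simp
  also have "\<dots> \<le> (\<Sum>i=j..<2*j. ln (real (K * i + 1)))"
  proof (rule sum_mono)
    fix i assume "i \<in> {j..<2*j}"
    then have "j \<le> K * i + 1" using K by (metis One_nat_def Suc_leI add.commute atLeastLessThan_iff le_SucI le_trans mult_le_mono1 mult_1 plus_1_eq_Suc)
    then show "ln (real j) \<le> ln (real (K * i + 1))" using j1 of_nat_mono[of j "K * i + 1", where ?'a = real]
      by (subst ln_le_cancel_iff) linarith+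
  qed
  also have "\<dots> = (\<Sum>n\<in>(\<lambda>i. K * i + 1) ` {j..<2*j}. c n * ln (real n))"
    using K by (subst sum.reindex) (auto simp: inj_on_def c_def cop intro!: sum.cong)
  also have "\<dots> \<le> (\<Sum>n=1..N. c n * ln (real n))"
  proof (rule sum_mono2)
    show "(\<lambda>i. K * i + 1) ` {j..<2*j} \<subseteq> {1..N}"
    proof clarsimp
      fix i assume "i < 2 * j"
      then have "K * Suc i \<le> K * (2 * j)" by (intro mult_le_mono2) simp
      then show "Suc (K * i) \<le> N" using K by (simp add: N_def algebra_simps)
    qed
  qed (auto simp: c_def)
  also have "\<dots> = (\<Sum>d=1..N. c d * \<Lambda> d * (\<Sum>m=1..N div d. c m))"
    by (rule sum_multiplicative_ln) (rule c_mult)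
  also have "\<dots> \<le> (\<Sum>d=1..N. c d * \<Lambda> d * (N / d))"
  proof (rule sum_mono)
    fix d assume "d \<in> {1..N}"
    have "(\<Sum>m=1..N div d. c m) \<le> (\<Sum>m=1..N div d. 1)" by (intro sum_mono) (simp add: c_def)
    also have "\<dots> \<le> N / d" using of_nat_div_le_of_nat[of N d] by simp
    finally show "c d * \<Lambda> d * (\<Sum>m=1..N div d. c m) \<le> c d * \<Lambda> d * (N / d)"
      by (intro mult_left_mono mult_nonneg_nonneg mangoldt_nonneg) (auto simp: c_def)
  qed
  also have "\<dots> = N * (\<Sum>d=1..N. c d * \<Lambda> d / d)" by (simp add: sum_distrib_left algebra_simps)
  finally have "j * ln j \<le> j * (2 * K * (\<Sum>d=1..N. c d * \<Lambda> d / d))" by (simp add: N_def algebra_simps)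
  then have "ln j \<le> 2 * K * (\<Sum>d=1..N. c d * \<Lambda> d / d)" using j1 by simp
  then have "2 * K * \<bar>B\<bar> < 2 * K * (\<Sum>d=1..N. c d * \<Lambda> d / d)" using lnj by linarith
  then have "\<bar>B\<bar> < (\<Sum>d=1..N. c d * \<Lambda> d / d)" using K by simp
  then show ?thesis unfolding c_def by (intro exI[of _ N]) linarith
qed

text \<open>Expanding \<open>\<Prod>e\<in>E. 1 + \<epsilon> e * \<psi> e d\<close> gives one real character for every subset of \<open>E\<close>;
  only the empty subset contributes an unbounded sum, so this product cannot vanish
  at all prime powers. If some \<open>\<epsilon> e = -1\<close>, the exponent of the prime power is odd and
  the prime itself has the same character values; otherwise 1 has them.\<close>
theorem exists_prime_with_character_values:
  fixes K :: nat and \<psi> :: "'i \<Rightarrow> nat \<Rightarrow> real" and \<epsilon> :: "'i \<Rightarrow> real"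
  assumes K: "K > 0" and E: "finite E"
    and mult: "\<And>e a b. e \<in> E \<Longrightarrow> \<psi> e (a * b) = \<psi> e a * \<psi> e b"
    and periodic: "\<And>e a. e \<in> E \<Longrightarrow> \<psi> e (a + K) = \<psi> e a"
    and unit: "\<And>e a. e \<in> E \<Longrightarrow> coprime a K \<Longrightarrow> \<psi> e a \<in> {-1, 1}"
    and indep: "\<And>S. S \<subseteq> E \<Longrightarrow> S \<noteq> {} \<Longrightarrow> \<exists>a. coprime a K \<and> (\<Prod>e\<in>S. \<psi> e a) = -1"
    and sign: "\<And>e. e \<in> E \<Longrightarrow> \<epsilon> e \<in> {-1, 1}"
  shows "\<exists>q. (q = 1 \<or> prime q) \<and> coprime q K \<and> (\<forall>e\<in>E. \<psi> e q = \<epsilon> e)"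
proof (rule ccontr)
  assume none: "\<not> ?thesis"
  define c :: "nat \<Rightarrow> real" where "c = (\<lambda>n. if coprime n K then 1 else 0)"
  define w where "w = (\<lambda>n. \<Prod>e\<in>E. \<epsilon> e * \<psi> e n + 1)"
  define \<chi> where "\<chi> = (\<lambda>S n. c n * (\<Prod>e\<in>S. \<psi> e n))"
  have unit_prod: "(\<Prod>e\<in>S. f e) \<in> {-1, 1}" if "\<And>e. e \<in> S \<Longrightarrow> f e \<in> {-1, 1::real}" for S :: "'i set" and f
  proof -
    have "\<bar>\<Prod>e\<in>S. f e\<bar> = 1" unfolding abs_prod using that by (intro prod.neutral ballI) fastforce
    then show ?thesis by (auto simp: abs_if split: if_splits)
  qed
  have psi_1: "\<psi> e 1 = 1" if "e \<in> E" for e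
    using mult[OF that, of 1 1] unit[OF that, of 1] by auto
  have psi_power: "\<psi> e (a ^ k) = \<psi> e a ^ k" if "e \<in> E" for e a k
    by (induction k) (use that psi_1[OF that] in \<open>auto simp: mult\<close>)
  have nonprincipal: "nonprincipal_real_character K (\<chi> S)" if S: "S \<subseteq> E" "S \<noteq> {}" for S
  proof
    fix a b :: nat
    show "K > 0" by (rule K)
    have "(\<Prod>e\<in>S. \<psi> e (a * b)) = (\<Prod>e\<in>S. \<psi> e a * \<psi> e b)"
      using S mult by (intro prod.cong) auto
    then show "\<chi> S (a * b) = \<chi> S a * \<chi> S b"
      by (simp add: \<chi>_def c_def prod.distrib)
    have "(\<Prod>e\<in>S. \<psi> e (a + K)) = (\<Prod>e\<in>S. \<psi> e a)"
      using S periodic by (intro prod.cong) auto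
    moreover have "coprime (a + K) K = coprime a K" by (simp only: coprime_iff_gcd_eq_1 gcd_add1)
    ultimately show "\<chi> S (a + K) = \<chi> S a" by (simp only: \<chi>_def c_def)
    have u: "(\<Prod>e\<in>S. \<psi> e a) \<in> {-1, 1}" if "coprime a K"
      using that S unit by (intro unit_prod) auto
    then show "\<chi> S a \<in> {-1, 0, 1}" by (auto simp: \<chi>_def c_def)
    show "\<chi> S a = 0 \<longleftrightarrow> \<not> coprime a K" using u by (auto simp: \<chi>_def c_def)
    show "\<exists>a. \<chi> S a = -1" using indep[OF S] by (auto simp: \<chi>_def c_def)
  qed
  have vanish: "c d * w d * \<Lambda> d = 0" for d
  proof (rule ccontr)
    assume nz: "c d * w d * \<Lambda> d \<noteq> 0"
    then have "primepow d" "coprime d K" by (auto simp: mangoldt_def c_def split: if_splits)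
    then obtain p k where pk: "prime p" "k > 0" "d = p ^ k" by (auto simp: primepow_def)
    have cop: "coprime p K" using \<open>coprime d K\<close> pk by simp
    have d: "\<psi> e d = \<epsilon> e" if "e \<in> E" for e
    proof -
      have "\<epsilon> e * \<psi> e d + 1 \<noteq> 0" using nz that E by (auto simp: w_def)
      then show ?thesis using sign[OF that] unit[OF that \<open>coprime d K\<close>] by auto
    qed
    show False
    proof (cases "\<forall>e\<in>E. \<epsilon> e = 1")
      case True
      have "\<not> (\<forall>e\<in>E. \<psi> e 1 = \<epsilon> e)" using none coprime_1_left by blast
      then show ?thesis using True psi_1 by simp
    next
      case False
      have sign_power: "x ^ k = (if even k then 1 else x)" if "x \<in> {-1, 1::real}" for x
        using that by auto
      obtain e where e: "e \<in> E" "\<epsilon> e = -1" using False sign by blast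
      have "\<psi> e p ^ k = -1" using d[OF e(1)] e pk psi_power by simp
      then have "odd k" using sign_power[OF unit[OF e(1) cop]] by auto
      then have "\<psi> e p = \<epsilon> e" if "e \<in> E" for e
        using d[OF that] pk(3) psi_power[OF that] sign_power[OF unit[OF that cop]] by simp
      then show False using none pk(1) cop by blast
    qed
  qed
  have expand: "c d * w d = c d + (\<Sum>S\<in>Pow E - {{}}. (\<Prod>e\<in>S. \<epsilon> e) * \<chi> S d)" for d
  proof -
    have "w d = (\<Sum>S\<in>Pow E. (\<Prod>e\<in>S. \<epsilon> e) * (\<Prod>e\<in>S. \<psi> e d))"
      unfolding w_def using E by (subst prod_add) (auto simp: prod.distrib)
    also have "\<dots> = 1 + (\<Sum>S\<in>Pow E - {{}}. (\<Prod>e\<in>S. \<epsilon> e) * (\<Prod>e\<in>S. \<psi> e d))"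
      using E by (subst sum.remove[of _ "{}"]) auto
    finally show ?thesis by (simp add: \<chi>_def algebra_simps sum_distrib_left)
  qed
  have "\<forall>S\<in>Pow E - {{}}. \<exists>C. \<forall>N. \<bar>\<Sum>d=1..N. \<chi> S d * \<Lambda> d / d\<bar> \<le> C"
    using nonprincipal nonprincipal_real_character.mangoldt_sum_bounded by blast
  then obtain C where C: "\<And>S N. S \<in> Pow E - {{}} \<Longrightarrow> \<bar>\<Sum>d=1..N. \<chi> S d * \<Lambda> d / d\<bar> \<le> C S"
    by metis
  obtain N where N: "(\<Sum>S\<in>Pow E - {{}}. C S) < (\<Sum>d=1..N. c d * \<Lambda> d / d)"
    using mangoldt_sum_coprime_unbounded[OF K] unfolding c_def by blast
  have "0 = (\<Sum>d=1..N. c d * w d * \<Lambda> d / d)" unfolding vanish by simp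
  also have "\<dots> = (\<Sum>d=1..N. c d * \<Lambda> d / d) + (\<Sum>d=1..N. \<Sum>S\<in>Pow E - {{}}. (\<Prod>e\<in>S. \<epsilon> e) * (\<chi> S d * \<Lambda> d / d))"
    unfolding expand
    by (simp add: distrib_right add_divide_distrib sum_distrib_right sum_divide_distrib sum.distrib mult.assoc)
  also have "\<dots> = (\<Sum>d=1..N. c d * \<Lambda> d / d) + (\<Sum>S\<in>Pow E - {{}}. (\<Prod>e\<in>S. \<epsilon> e) * (\<Sum>d=1..N. \<chi> S d * \<Lambda> d / d))"
    by (subst sum.swap) (simp add: sum_distrib_left)
  finally have "(\<Sum>d=1..N. c d * \<Lambda> d / d) = - (\<Sum>S\<in>Pow E - {{}}. (\<Prod>e\<in>S. \<epsilon> e) * (\<Sum>d=1..N. \<chi> S d * \<Lambda> d / d))"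
    by linarith
  also have "\<dots> \<le> (\<Sum>S\<in>Pow E - {{}}. C S)"
    unfolding sum_negf[symmetric]
  proof (rule sum_mono)
    fix S assume S: "S \<in> Pow E - {{}}"
    then have "(\<Prod>e\<in>S. \<epsilon> e) \<in> {-1, 1}" using sign by (intro unit_prod) auto
    then show "- ((\<Prod>e\<in>S. \<epsilon> e) * (\<Sum>d=1..N. \<chi> S d * \<Lambda> d / d)) \<le> C S"
      using C[OF S, of N] by auto
  qed
  finally show False using N by simp
qed

section \<open>Primes with prescribed Legendre symbols\<close>

lemma Legendre_range: "Legendre a p \<in> {-1, 0, 1}"
  by (simp add: Legendre_def)

lemma Legendre_eq_0_iff: "Legendre a p = 0 \<longleftrightarrow> p dvd a"
  by (simp add: Legendre_def cong_0_iff)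

lemma Legendre_cong: "[a = b] (mod p) \<Longrightarrow> Legendre a p = Legendre b p"
  by (simp add: Legendre_def QuadRes_def cong_def)

text \<open>Turns the congruence in Euler's criterion into an equality.\<close>

lemma sign_cong_imp_eq:
  fixes x y :: int
  assumes "[x = y] (mod int p)" "2 < p" "x \<in> {-1, 0, 1}" "y \<in> {-1, 0, 1}"
  shows "x = y"
proof -
  have "int p dvd x - y" using assms(1) by (simp add: cong_iff_dvd_diff)
  moreover have "\<bar>x - y\<bar> < int p" using assms by auto
  ultimately show ?thesis using dvd_imp_le_int[of "x - y" "int p"] by auto
qed

lemma Legendre_mult:
  assumes p: "prime p" "2 < p"
  shows "Legendre (a * b) (int p) = Legendre a (int p) * Legendre b (int p)"
proof (rule sign_cong_imp_eq)
  let ?h = "(p - 1) div 2"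
  have "[Legendre (a * b) p = a ^ ?h * b ^ ?h] (mod int p)"
    using euler_criterion[OF p, of "a * b"] by (simp add: power_mult_distrib)
  moreover have "[Legendre a p * Legendre b p = a ^ ?h * b ^ ?h] (mod int p)"
    by (intro cong_mult euler_criterion p)
  ultimately show "[Legendre (a * b) p = Legendre a p * Legendre b p] (mod int p)"
    by (meson cong_sym cong_trans)
  show "Legendre a (int p) * Legendre b (int p) \<in> {-1, 0, 1}"
    using Legendre_range[of a p] Legendre_range[of b p] by auto
qed (use p Legendre_range[of "a * b" p] in auto)

lemma Legendre_minus_1:
  assumes p: "prime p" "2 < p"
  shows "Legendre (-1) (int p) = (-1) ^ ((p - 1) div 2)"
proof (rule sign_cong_imp_eq)
  show "(-1::int) ^ ((p - 1) div 2) \<in> {-1, 0, 1}" by (cases "even ((p - 1) div 2)") auto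
qed (use euler_criterion[OF p, of "-1"] p Legendre_range[of "-1" p] in auto)

text \<open>Gauss's lemma: with \<open>h = (p - 1) div 2\<close>, the doubles \<open>2 * x\<close>
  for \<open>x \<le> h\<close> are already reduced modulo \<open>p\<close>, and those exceeding
  \<open>h\<close> come from \<open>h div 2 < x\<close>. The parity of their number
  \<open>h - h div 2\<close> depends only on \<open>p mod 8\<close>.\<close>

lemma Legendre_2:
  assumes p: "prime p" "2 < p"
  shows "Legendre 2 (int p) = (if p mod 8 \<in> {1, 7} then 1 else -1)"
proof -
  have "odd p" using p prime_odd_nat by auto
  have "[(2::int) \<noteq> 0] (mod int p)" using p zdvd_not_zless[of 2 "int p"] zdvd_imp_le[of "int p" 2]
    by (auto simp: cong_0_iff)
  then interpret GAUSS p 2 using p by unfold_locales auto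
  define h where "h = (p - 1) div 2"
  have ph: "int p = 2 * int h + 1" using \<open>odd p\<close> p by (auto simp: h_def elim!: oddE)
  have "E = (\<lambda>x. 2 * int x) ` {h div 2 <.. h}"
  proof (intro equalityI subsetI)
    fix y assume "y \<in> E"
    then obtain x where x: "0 < x" "x \<le> int h" "y = (x * 2) mod int p" "int h < y"
      by (auto simp: E_def C_def B_def A_def ph)
    then have "y = 2 * x" using ph by simp
    then show "y \<in> (\<lambda>x. 2 * int x) ` {h div 2 <.. h}"
      using x by (intro image_eqI[of _ _ "nat x"]) auto
  next
    fix y assume "y \<in> (\<lambda>x. 2 * int x) ` {h div 2 <.. h}"
    then obtain x where x: "h div 2 < x" "x \<le> h" "y = 2 * int x" by auto
    then have "y = (int x * 2) mod int p" "int h < y" "0 < int x" "int x \<le> int h" using ph by auto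
    then have "y \<in> C" unfolding C_def B_def image_image A_def
      by (intro image_eqI[of _ _ "int x"]) (auto simp: ph)
    then show "y \<in> E" using \<open>int h < y\<close> by (simp add: E_def ph)
  qed
  then have "card E = h - h div 2" by (simp add: card_image inj_on_def)
  then have L: "Legendre 2 (int p) = (-1) ^ (h - h div 2)" using gauss_lemma by simp
  have "p = 2 * h + 1" using ph by linarith
  moreover have "p mod 8 \<in> {1, 7} \<longleftrightarrow> even (h - h div 2)"
  proof -
    define k where "k = h div 4"
    consider "h = 4 * k" | "h = 4 * k + 1" | "h = 4 * k + 2" | "h = 4 * k + 3"
      unfolding k_def by linarith
    then show ?thesis unfolding \<open>p = 2 * h + 1\<close>
    proof cases
      case 1
      then have "(2 * h + 1) mod 8 = 1" "h - h div 2 = 2 * k" by presburger+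
      then show "((2 * h + 1) mod 8 \<in> {1, 7}) = even (h - h div 2)" by simp
    next
      case 2
      then have "(2 * h + 1) mod 8 = 3" "h - h div 2 = 2 * k + 1" by presburger+
      then show "((2 * h + 1) mod 8 \<in> {1, 7}) = even (h - h div 2)" by simp
    next
      case 3
      then have "(2 * h + 1) mod 8 = 5" "h - h div 2 = 2 * k + 1" by presburger+
      then show "((2 * h + 1) mod 8 \<in> {1, 7}) = even (h - h div 2)" by simp
    next
      case 4
      then have "(2 * h + 1) mod 8 = 7" "h - h div 2 = 2 * (k + 1)" by presburger+
      then show "((2 * h + 1) mod 8 \<in> {1, 7}) = even (h - h div 2)" by simp
    qed
  qed
  ultimately show ?thesis using L by auto
qed

text \<open>Squaring identifies 1 with \<open>p - 1\<close>, so it is not injective on the residues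
  and hence misses one; the missed residue is nonzero because 0 is a square.\<close>

lemma exists_nonresidue:
  assumes p: "prime p" "2 < p"
  shows "\<exists>a. Legendre (int a) (int p) = -1"
proof -
  let ?f = "\<lambda>y. y\<^sup>2 mod p"
  have "\<not> inj_on ?f {..<p}"
  proof
    assume inj: "inj_on ?f {..<p}"
    define j where "j = p - 2"
    then have j: "p = j + 2" using p(2) by linarith
    have "(p - 1)\<^sup>2 = 1 + p * j" by (simp add: j power2_eq_square)
    then have "?f (p - 1) = ?f 1" by (simp only: mod_mult_self2 power_one)
    then have "p - 1 = 1" using inj_onD[OF inj, of "p - 1" 1] p by simp
    then show False using p by simp
  qed
  then have "?f ` {..<p} \<noteq> {..<p}" using eq_card_imp_inj_on[of "{..<p}" ?f] by fastforce
  moreover have "?f ` {..<p} \<subseteq> {..<p}" using p by auto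
  ultimately obtain a where a: "a < p" "a \<notin> ?f ` {..<p}" by blast
  have "\<not> QuadRes (int p) (int a)"
  proof
    assume "QuadRes (int p) (int a)"
    then obtain y where y: "[y\<^sup>2 = int a] (mod int p)" by (auto simp: QuadRes_def)
    define z where "z = nat (y mod int p)"
    have z: "int z = y mod int p" "z < p" using p by (auto simp: z_def nat_less_iff)
    have "[(int z)\<^sup>2 = int a] (mod int p)" using y unfolding z by (simp add: cong_def power_mod)
    then have "[z\<^sup>2 = a] (mod p)" by (simp flip: cong_int_iff)
    then have "?f z = a" using a by (simp add: cong_def)
    then show False using a z by blast
  qed
  moreover have "\<not> [int a = 0] (mod int p)"
  proof
    assume "[int a = 0] (mod int p)"
    then have "a = 0" using a by (simp add: cong_def)
    then have "a \<in> ?f ` {..<p}" using p(2) by (intro image_eqI[of _ _ 0]) auto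
    then show False using a(2) by contradiction
  qed
  ultimately show ?thesis by (auto simp: Legendre_def)
qed

section \<open>The characters modulo 4 and 8\<close>

text \<open>At odd arguments this is the Jacobi symbol (-1/a), and \<open>chi8\<close> is
  (2/a).\<close>

definition chi4 :: "nat \<Rightarrow> int" where
  "chi4 a = (if a mod 4 = 1 then 1 else if a mod 4 = 3 then -1 else 0)"

definition chi8 :: "nat \<Rightarrow> int" where
  "chi8 a = (if a mod 8 \<in> {1, 7} then 1 else if a mod 8 \<in> {3, 5} then -1 else 0)"

lemma chi4_mult: "chi4 (a * b) = chi4 a * chi4 b"
proof -
  have "\<forall>x\<in>{0,1,2,3}. \<forall>y\<in>{0,1,2,3}. chi4 (x * y) = chi4 x * chi4 y"
    by (simp add: chi4_def)
  moreover have "x mod 4 \<in> {0,1,2,3}" for x :: nat by auto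
  ultimately have "chi4 ((a mod 4) * (b mod 4)) = chi4 (a mod 4) * chi4 (b mod 4)" by blast
  then show ?thesis unfolding chi4_def by (simp only: mod_mult_eq mod_mod_trivial)
qed

lemma chi8_mult: "chi8 (a * b) = chi8 a * chi8 b"
proof -
  have "\<forall>x\<in>{0,1,2,3,4,5,6,7}. \<forall>y\<in>{0,1,2,3,4,5,6,7}. chi8 (x * y) = chi8 x * chi8 y"
    by (simp add: chi8_def)
  moreover have "x mod 8 \<in> {0,1,2,3,4,5,6,7}" for x :: nat by auto
  ultimately have "chi8 ((a mod 8) * (b mod 8)) = chi8 (a mod 8) * chi8 (b mod 8)" by blast
  then show ?thesis unfolding chi8_def by (simp only: mod_mult_eq mod_mod_trivial)
qed

lemma Legendre_minus_1_chi4: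
  assumes p: "prime p" "2 < p"
  shows "Legendre (-1) (int p) = chi4 p"
proof -
  define k where "k = p div 4"
  have "odd p" using p prime_odd_nat by auto
  then have "p mod 4 = 1 \<or> p mod 4 = 3" by presburger
  then consider "p = 4 * k + 1" | "p = 4 * k + 3"
    using mult_div_mod_eq[of 4 p] unfolding k_def by metis
  then show ?thesis
  proof cases
    case 1
    then have "(p - 1) div 2 = 2 * k" "p mod 4 = 1" by presburger+
    then show ?thesis using Legendre_minus_1[OF p] by (simp add: chi4_def)
  next
    case 2
    then have "(p - 1) div 2 = 2 * k + 1" "p mod 4 = 3" by presburger+
    then show ?thesis using Legendre_minus_1[OF p] by (simp add: chi4_def)
  qed
qed

lemma Legendre_2_chi8:
  assumes p: "prime p" "2 < p"
  shows "Legendre 2 (int p) = chi8 p"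
proof -
  have "odd p" using p prime_odd_nat by auto
  then have "p mod 8 = 1 \<or> p mod 8 = 3 \<or> p mod 8 = 5 \<or> p mod 8 = 7" by presburger
  then show ?thesis using Legendre_2[OF p] by (auto simp: chi8_def)
qed

lemma chi4_prod: "chi4 (\<Prod>p\<in>P. f p) = (\<Prod>p\<in>P. chi4 (f p))"
  by (induction P rule: infinite_finite_induct) (auto simp: chi4_mult, simp_all add: chi4_def)

lemma chi8_prod: "chi8 (\<Prod>p\<in>P. f p) = (\<Prod>p\<in>P. chi8 (f p))"
  by (induction P rule: infinite_finite_induct) (auto simp: chi8_mult, simp_all add: chi8_def)

lemma Legendre_prod:
  assumes q: "prime q" "2 < q"
  shows "Legendre (\<Prod>p\<in>P. f p) (int q) = (\<Prod>p\<in>P. Legendre (f p) (int q))"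
proof (induction P rule: infinite_finite_induct)
  case (insert x F)
  then show ?case by (simp add: Legendre_mult[OF q])
qed (use Legendre_mult[OF q, of 1 1] Legendre_range[of 1 q] Legendre_eq_0_iff[of 1 q] q in auto)

lemma Legendre_1_imp_dvd:
  assumes "Legendre a p = 1"
  shows "\<exists>y. p dvd y\<^sup>2 - a"
  using assms by (auto simp: Legendre_def QuadRes_def cong_iff_dvd_diff split: if_splits)

text \<open>\<open>chi4\<close>, \<open>chi8\<close> and the Legendre symbols modulo the primes in
  \<open>P\<close> are real characters modulo \<open>K\<close>; the Chinese remainder theorem makes
  them independent.\<close>

lemma exists_prime_with_residues:
  fixes P :: "nat set" and \<epsilon> :: "nat \<Rightarrow> int"
  assumes P: "finite P" "\<And>p. p \<in> P \<Longrightarrow> prime p" "\<And>p. p \<in> P \<Longrightarrow> 2 < p"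
    and \<epsilon>: "\<And>p. p \<in> P \<Longrightarrow> \<epsilon> p \<in> {-1, 1}" and \<delta>: "\<delta> \<in> {-1, 1}"
  shows "\<exists>q. (q = 1 \<or> prime q) \<and> q mod 4 = 1 \<and> chi8 q = \<delta> \<and> (\<forall>p\<in>P. Legendre (int q) (int p) = \<epsilon> p)"
proof -
  define K where "K = 8 * \<Prod>P"
  \<comment> \<open>The indices 4 and 8 stand for \<open>chi4\<close> and \<open>chi8\<close>; being
    composite, they cannot clash with members of \<open>P\<close>.\<close>
  define E where "E = {4, 8} \<union> P"
  define \<psi> where "\<psi> = (\<lambda>e a. real_of_int (if e = 4 then chi4 a else if e = 8 then chi8 a else Legendre (int a) (int e)))"
  define \<eta> where "\<eta> = (\<lambda>e. real_of_int (if e = 4 then 1 else if e = 8 then \<delta> else \<epsilon> e))"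
  have not_prime: "4 \<notin> P" "8 \<notin> P"
  proof -
    have "\<not> prime (4::nat)" "\<not> prime (8::nat)"
      using prime_product[of 2 2] prime_product[of 2 4] by auto
    then show "4 \<notin> P" "8 \<notin> P" using P by blast+
  qed
  have dvd_K: "p dvd K" if "p \<in> P" for p using that P(1) by (simp add: K_def dvd_prod_eqI dvd_mult)
  have coprime_K: "coprime a K \<longleftrightarrow> odd a \<and> (\<forall>p\<in>P. Legendre (int a) (int p) \<noteq> 0)" for a
  proof -
    have "coprime a 8 \<longleftrightarrow> odd a"
      using coprime_power_right_iff[of a 2 3] by simp
    moreover have "coprime a (\<Prod>P) \<longleftrightarrow> (\<forall>p\<in>P. coprime a p)"
      using P(1) by (induction P rule: finite_induct) auto
    moreover have "coprime a p \<longleftrightarrow> Legendre (int a) (int p) \<noteq> 0" if "p \<in> P" for p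
      using P(2)[OF that] prime_imp_coprime[of p a] by (auto simp: Legendre_eq_0_iff coprime_commute prime_nat_iff dest: coprime_common_divisor)
    ultimately show ?thesis by (simp add: K_def)
  qed
  have "\<exists>q. (q = 1 \<or> prime q) \<and> coprime q K \<and> (\<forall>e\<in>E. \<psi> e q = \<eta> e)"
  proof (rule exists_prime_with_character_values)
    show "K > 0" using P prime_gt_0_nat by (auto simp: K_def intro!: prod_pos)
    show "finite E" using P by (simp add: E_def)
  next
    fix e a b assume "e \<in> E"
    then show "\<psi> e (a * b) = \<psi> e a * \<psi> e b"
      using P Legendre_mult[of e "int a" "int b"] by (auto simp: \<psi>_def E_def chi4_mult chi8_mult)
  next
    fix e a assume e: "e \<in> E"
    have "8 dvd K" by (simp add: K_def)
    then have "(a + K) mod 8 = a mod 8" by (auto elim!: dvdE)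
    moreover have "(a + K) mod 4 = a mod 4" using \<open>8 dvd K\<close> by (metis calculation mod_mod_cancel dvd_triv_left mult_2_right numeral_Bit0 dvd_def numeral_times_numeral)
    moreover have "Legendre (int (a + K)) (int e) = Legendre (int a) (int e)" if "e \<in> P"
    proof (rule Legendre_cong)
      have "int e dvd int K" using dvd_K[OF that] by simp
      then show "[int (a + K) = int a] (mod int e)" by (simp add: cong_iff_dvd_diff)
    qed
    ultimately show "\<psi> e (a + K) = \<psi> e a" using e by (auto simp: \<psi>_def E_def chi4_def chi8_def)
  next
    fix e a assume "e \<in> E" "coprime a K"
    moreover from this have "odd a" using coprime_K by blast
    then have "a mod 8 = 1 \<or> a mod 8 = 3 \<or> a mod 8 = 5 \<or> a mod 8 = 7" "a mod 4 = 1 \<or> a mod 4 = 3" by presburger+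
    then have "chi8 a \<in> {-1, 1}" "chi4 a \<in> {-1, 1}" by (auto simp: chi8_def chi4_def)
    ultimately show "\<psi> e a \<in> {-1, 1}" using Legendre_range[of a e] coprime_K[of a] by (auto simp: \<psi>_def E_def)
  next
    fix e assume "e \<in> E"
    then show "\<eta> e \<in> {-1, 1}" using \<epsilon>[of e] \<delta> by (auto simp: \<eta>_def E_def)
  next
    fix S assume S: "S \<subseteq> E" "S \<noteq> {}"
    have "\<exists>p a. (S \<inter> P = {} \<or> p \<in> S \<inter> P \<and> Legendre (int a) (int p) = -1)"
      using exists_nonresidue P by blast
    then obtain p0 a0 where p0: "S \<inter> P = {} \<or> p0 \<in> S \<inter> P \<and> Legendre (int a0) (int p0) = -1" by blast
    \<comment> \<open>Target residues of \<open>a\<close>. If \<open>S\<close> meets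
      \<open>P\<close>, a nonresidue at \<open>p0\<close> and 1 elsewhere make exactly one factor
      -1. Otherwise 5 has \<open>chi4 = 1\<close> and \<open>chi8 = -1\<close>, and 7 has the
      opposite signs.\<close>
    define u where "u = (\<lambda>i::nat. if S \<inter> P = {} then (if i = 8 then (if 8 \<in> S then 5 else 7) else 1)
      else if i = p0 then a0 else 1)"
    have cop: "coprime i j" if "i \<in> insert 8 P" "j \<in> insert 8 P" "i \<noteq> j" for i j
    proof -
      have "coprime p 8" if "p \<in> P" for p
        using P(2,3)[OF that] prime_odd_nat[of p] coprime_power_right_iff[of p 2 3] by simp
      then show ?thesis using that P(2)[of i] P(2)[of j] primes_coprime[of i j] by (auto simp: coprime_commute)
    qed
    then obtain a where a: "\<And>i. i \<in> insert 8 P \<Longrightarrow> [a = u i] (mod i)"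
      using chinese_remainder_nat[of "insert 8 P" "\<lambda>i. i" u] P(1) by auto
    have a8: "a mod 8 = u 8 mod 8" using a[of 8] by (simp add: cong_def)
    have a4: "a mod 4 = u 8 mod 4"
    proof -
      have "a mod 8 mod 4 = a mod 4" "u 8 mod 8 mod 4 = u 8 mod 4" by (simp_all add: mod_mod_cancel)
      then show ?thesis using a8 by metis
    qed
    have leg: "Legendre (int a) (int p) = Legendre (int (u p)) (int p)" if "p \<in> P" for p
      using a[of p] that by (intro Legendre_cong) (auto simp: cong_int_iff)
    have leg1: "Legendre 1 (int p) = 1" if "p \<in> P" for p
      using Legendre_prod[of p "\<lambda>_. 1" "{}"] P that by auto
    have leg_u: "Legendre (int a) (int p) = (if S \<inter> P \<noteq> {} \<and> p = p0 then -1 else 1)" if "p \<in> P" for p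
      proof -
      have "p \<noteq> 8" using that not_prime by blast
      then show ?thesis using leg[OF that] leg1[OF that] p0 by (auto simp: u_def)
    qed
    have u8: "u 8 = (if S \<inter> P = {} then (if 8 \<in> S then 5 else 7) else 1)"
      using not_prime p0 by (auto simp: u_def)
    have "odd a"
    proof -
      have "a mod 4 = 1 \<or> a mod 4 = 3" using a4 u8 by (auto split: if_splits)
      then show ?thesis by presburger
    qed
    then have "coprime a K" using coprime_K leg_u by auto
    moreover have "(\<Prod>e\<in>S. \<psi> e a) = -1"
    proof (cases "S \<inter> P = {}")
      case True
      then have "S = {4} \<or> S = {8} \<or> S = {4, 8}" using S unfolding E_def by blast
      then show ?thesis using a8 a4 u8 True by (elim disjE) (simp_all add: \<psi>_def chi4_def chi8_def)
    next
      case False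
      have fin: "finite S" using S P(1) finite_subset[of S E] by (simp add: E_def)
      have "(\<Prod>e\<in>S. \<psi> e a) = \<psi> p0 a * (\<Prod>e\<in>S - {p0}. \<psi> e a)"
        using False p0 fin by (intro prod.remove) auto
      moreover have "(\<Prod>e\<in>S - {p0}. \<psi> e a) = 1"
      proof (intro prod.neutral ballI)
        fix e assume "e \<in> S - {p0}"
        then show "\<psi> e a = 1" using S leg_u[of e] a8 a4 u8 False
          by (auto simp: \<psi>_def E_def chi4_def chi8_def)
      qed
      moreover have "\<psi> p0 a = -1" using False p0 leg_u[of p0] not_prime by (auto simp: \<psi>_def)
      ultimately show ?thesis by simp
    qed
    ultimately show "\<exists>a. coprime a K \<and> (\<Prod>e\<in>S. \<psi> e a) = -1" by blast
  qed
  then obtain q where q: "q = 1 \<or> prime q" "\<And>e. e \<in> E \<Longrightarrow> \<psi> e q = \<eta> e" by blast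
  have "chi4 q = 1" using q(2)[of 4] by (simp add: \<psi>_def \<eta>_def E_def)
  then have "q mod 4 = 1" by (auto simp: chi4_def split: if_splits)
  moreover have "chi8 q = \<delta>" using q(2)[of 8] by (simp add: \<psi>_def \<eta>_def E_def)
  moreover have "Legendre (int q) (int p) = \<epsilon> p" if "p \<in> P" for p
    using q(2)[of p] that not_prime by (auto simp: \<psi>_def \<eta>_def E_def split: if_splits)
  ultimately show ?thesis using q(1) by blast
qed

section \<open>Sums of three squares\<close>

text \<open>Here \<open>c\<close> is the square root of \<open>m\<close> rounded up. It serves as a
  side of the pigeonhole box: numbers below \<open>c\<close> differ by less than the square root of
  \<open>m\<close>.\<close>

lemma Least_square_bound:
  fixes m :: nat
  obtains c where "m \<le> c\<^sup>2" "\<And>k. k < c \<Longrightarrow> k\<^sup>2 < m"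
proof
  have "m \<le> m\<^sup>2" by (cases m) (auto simp: power2_eq_square)
  then show "m \<le> (LEAST k. m \<le> k\<^sup>2)\<^sup>2" by (rule LeastI)
  show "k\<^sup>2 < m" if "k < (LEAST k. m \<le> k\<^sup>2)" for k using not_less_Least[OF that] by simp
qed

text \<open>The boxes of side lengths about \<open>\<surd>(nQ)\<close>, \<open>\<surd>n\<close> and \<open>\<surd>Q\<close> contain more than \<open>nQ\<close> points,
  so two of them are congruent modulo the lattice \<open>z \<equiv> r t (mod n)\<close>, \<open>z \<equiv> s w (mod Q)\<close>.
  The form \<open>z\<^sup>2 + Q t\<^sup>2 - n w\<^sup>2\<close> takes one of the values \<open>0\<close> and \<open>nQ\<close> at their difference.\<close>
lemma legendre_equation_solvable:
  fixes n Q :: nat and r s :: int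
  assumes pos: "n > 0" "Q > 0" and cop: "coprime n Q" and nonsquare: "\<And>k::nat. n \<noteq> k\<^sup>2"
    and r: "int n dvd r\<^sup>2 + int Q" and s: "int Q dvd s\<^sup>2 - int n"
  shows "\<exists>z t w :: int. w \<noteq> 0 \<and> int n * w\<^sup>2 = z\<^sup>2 + int Q * t\<^sup>2"
proof -
  obtain c1 where c1: "n * Q \<le> c1\<^sup>2" "\<And>k. k < c1 \<Longrightarrow> k\<^sup>2 < n * Q" by (rule Least_square_bound) blast
  obtain c2 where c2: "n \<le> c2\<^sup>2" "\<And>k. k < c2 \<Longrightarrow> k\<^sup>2 < n" by (rule Least_square_bound) blast
  obtain c3 where c3: "Q \<le> c3\<^sup>2" "\<And>k. k < c3 \<Longrightarrow> k\<^sup>2 < Q" by (rule Least_square_bound) blast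
  have "(n * Q)\<^sup>2 = (n * Q) * (n * Q)" by (simp add: power2_eq_square)
  \<comment> \<open>The strict excess of points over residue pairs comes from \<open>n\<close> not
    being a square.\<close>
  also have "\<dots> < (n * Q) * (c2\<^sup>2 * Q)" using pos c2(1) nonsquare[of c2] by simp
  also have "\<dots> \<le> c1\<^sup>2 * (c2\<^sup>2 * c3\<^sup>2)" using c1(1) c3(1) by (intro mult_mono) auto
  also have "\<dots> = (c1 * (c2 * c3))\<^sup>2" by (simp add: power_mult_distrib)
  finally have big: "n * Q < c1 * (c2 * c3)" by (rule power_less_imp_less_base) simp
  define B where "B = {..<c1} \<times> {..<c2} \<times> {..<c3}"
  define f where "f = (\<lambda>(z,t,w). ((int z - r * int t) mod int n, (int z - s * int w) mod int Q))"
  have "card (f ` B) \<le> card ({0..<int n} \<times> {0..<int Q})"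
    using pos by (intro card_mono) (auto simp: f_def)
  also have "\<dots> < card B" using big by (simp add: B_def card_cartesian_product)
  finally have "\<not> inj_on f B" by (rule pigeonhole)
  then obtain a b where ab: "a \<in> B" "b \<in> B" "a \<noteq> b" "f a = f b" unfolding inj_on_def by blast
  obtain z1 t1 w1 where a: "a = (z1,t1,w1)" by (cases a)
  obtain z2 t2 w2 where b: "b = (z2,t2,w2)" by (cases b)
  note pts = ab[unfolded a b]
  define z t w where "z = int z1 - int z2" and "t = int t1 - int t2" and "w = int w1 - int w2"
  have nz: "z \<noteq> 0 \<or> t \<noteq> 0 \<or> w \<noteq> 0" using pts(3) by (auto simp: z_def t_def w_def)
  have small: "(int a - int b)\<^sup>2 < int m" if "a < c" "b < c" "\<And>k. k < c \<Longrightarrow> k\<^sup>2 < m" for a b c m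
  proof -
    have "(int a - int b)\<^sup>2 \<le> (int (max a b))\<^sup>2" by (subst abs_le_square_iff[symmetric]) auto
    also have "\<dots> < int m" using that(3)[of "max a b"] that(1,2) by (simp flip: of_nat_power)
    finally show ?thesis .
  qed
  have bounds: "z\<^sup>2 < int n * int Q" "t\<^sup>2 < int n" "w\<^sup>2 < int Q"
    using pts(1,2) small[OF _ _ c1(2)] small[OF _ _ c2(2)] small[OF _ _ c3(2)]
    by (auto simp: B_def z_def t_def w_def simp flip: of_nat_mult)
  have "int n dvd (int z1 - r * int t1) - (int z2 - r * int t2)" "int Q dvd (int z1 - s * int w1) - (int z2 - s * int w2)"
    using pts(4) by (simp_all add: f_def mod_eq_dvd_iff)
  then have lat: "int n dvd z - r * t" "int Q dvd z - s * w"
    by (simp_all add: z_def t_def w_def algebra_simps)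
  define v where "v = z\<^sup>2 + int Q * t\<^sup>2 - int n * w\<^sup>2"
  have "v = (z - r * t) * (z + r * t) + (r\<^sup>2 + int Q) * t\<^sup>2 - int n * w\<^sup>2"
    by (simp add: v_def power2_eq_square algebra_simps)
  then have n_dvd: "int n dvd v" using lat(1) r by simp
  have "v = (z - s * w) * (z + s * w) + (s\<^sup>2 - int n) * w\<^sup>2 + int Q * t\<^sup>2"
    by (simp add: v_def power2_eq_square algebra_simps)
  then have "int Q dvd v" using lat(2) s by simp
  then have "int n * int Q dvd v" using n_dvd cop by (simp add: divides_mult)
  then obtain k where k: "v = int n * int Q * k" by blast
  have Qt: "int Q * t\<^sup>2 < int Q * int n" and nw: "int n * w\<^sup>2 < int n * int Q"
    using bounds pos by simp_all
  have "int n * int Q * k < int n * int Q * 2"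
    using bounds(1) Qt zero_le_power2[of w] pos unfolding k[symmetric] v_def
    by (smt (verit) mult.commute mult_nonneg_nonneg of_nat_0_le_iff)
  moreover have "int n * int Q * (-1) < int n * int Q * k"
    using nw zero_le_power2[of z] zero_le_power2[of t] unfolding k[symmetric] v_def
    by (smt (verit) mult.commute mult_nonneg_nonneg of_nat_0_le_iff)
  moreover have "0 < int n * int Q" using pos by simp
  ultimately have "k < 2" "-1 < k" by (simp_all only: mult_less_cancel_left_pos)
  then consider "k = 0" | "k = 1" by linarith
  then show ?thesis
  proof cases
    case 1
    then have eq: "int n * w\<^sup>2 = z\<^sup>2 + int Q * t\<^sup>2" using k by (simp add: v_def)
    have "w \<noteq> 0"
    proof
      assume "w = 0"
      then have "z\<^sup>2 + int Q * t\<^sup>2 = 0" using eq by simp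
      then have "z\<^sup>2 = 0" "int Q * t\<^sup>2 = 0"
        using add_nonneg_eq_0_iff[of "z\<^sup>2" "int Q * t\<^sup>2"] by simp_all
      then show False using nz \<open>w = 0\<close> pos by auto
    qed
    then show ?thesis using eq by blast
  next
    \<comment> \<open>The value \<open>n * Q\<close> means
      \<open>n * (w\<^sup>2 + Q) = z\<^sup>2 + Q * t\<^sup>2\<close>. Multiplying by
      \<open>w\<^sup>2 + Q\<close> and applying Brahmagupta's identity gives a solution with
      \<open>w\<close> replaced by \<open>w\<^sup>2 + Q\<close>.\<close>
    case 2
    let ?w = "w\<^sup>2 + int Q"
    have "?w > 0" using pos by (simp add: add_nonneg_pos)
    have "int n * ?w = z\<^sup>2 + int Q * t\<^sup>2" using k 2 by (simp add: v_def algebra_simps)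
    then have "int n * ?w\<^sup>2 = (z\<^sup>2 + int Q * t\<^sup>2) * ?w" by (simp add: power2_eq_square[of ?w] flip: mult.assoc)
    also have "\<dots> = (z * w + int Q * t)\<^sup>2 + int Q * (z - t * w)\<^sup>2"
      by (simp add: power2_eq_square algebra_simps)
    finally show ?thesis using \<open>?w > 0\<close> by (intro exI[of _ "z * w + int Q * t"] exI[of _ "z - t * w"] exI[of _ ?w]) auto
  qed
qed

section \<open>Davenport-Cassels descent\<close>

lemma nearest_multiple:
  fixes x w :: int
  assumes "w > 0"
  obtains X where "4 * (x - w * X)\<^sup>2 \<le> w\<^sup>2"
proof
  define X where "X = (2 * x + w) div (2 * w)"
  define R where "R = (2 * x + w) mod (2 * w)"
  have "2 * w * X + R = 2 * x + w" unfolding X_def R_def by (rule mult_div_mod_eq)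
  then have "2 * (x - w * X) = R - w" by (simp add: algebra_simps)
  moreover have "0 \<le> R" "R < 2 * w" using assms by (auto simp: R_def)
  ultimately have "\<bar>2 * (x - w * X)\<bar> \<le> \<bar>w\<bar>" by linarith
  then have "(2 * (x - w * X))\<^sup>2 \<le> w\<^sup>2" by (simp only: abs_le_square_iff)
  then show "4 * (x - w * X)\<^sup>2 \<le> w\<^sup>2" unfolding power_mult_distrib by simp
qed

text \<open>Davenport--Cassels descent: the line joining the rational point \<open>(x, y, z) / w\<close> on the sphere
  to a nearest integer point meets the sphere again in a point with smaller denominator.\<close>
lemma rational_sum_three_squares:
  fixes n w x y z :: int
  assumes "w \<noteq> 0" "n * w\<^sup>2 = x\<^sup>2 + y\<^sup>2 + z\<^sup>2"
  shows "\<exists>a b c :: int. n = a\<^sup>2 + b\<^sup>2 + c\<^sup>2"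
proof -
  have "n * w\<^sup>2 = x\<^sup>2 + y\<^sup>2 + z\<^sup>2 \<Longrightarrow> w > 0 \<Longrightarrow> \<exists>a b c :: int. n = a\<^sup>2 + b\<^sup>2 + c\<^sup>2" for w
  proof (induction "nat w" arbitrary: w x y z rule: less_induct)
    case less
    note eq = less.prems(1) and w = less.prems(2)
    obtain X where X: "4 * (x - w * X)\<^sup>2 \<le> w\<^sup>2" using nearest_multiple[OF w] by blast
    obtain Y where Y: "4 * (y - w * Y)\<^sup>2 \<le> w\<^sup>2" using nearest_multiple[OF w] by blast
    obtain Z where Z: "4 * (z - w * Z)\<^sup>2 \<le> w\<^sup>2" using nearest_multiple[OF w] by blast
    \<comment> \<open>\<open>D / w\<^sup>2\<close> is the squared distance to the nearest integer
      point, at most 3/4. The new denominator is \<open>A * w + B = D / w\<close>, hence smaller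
      than \<open>w\<close>, and the new numerators are \<open>A * x + B * X\<close> and so
      on.\<close>
    define D where "D = (x - w * X)\<^sup>2 + (y - w * Y)\<^sup>2 + (z - w * Z)\<^sup>2"
    define A where "A = X\<^sup>2 + Y\<^sup>2 + Z\<^sup>2 - n"
    define B where "B = 2 * (n * w - (x * X + y * Y + z * Z))"
    have "D \<ge> 0" by (simp add: D_def)
    have D_le: "4 * D \<le> 3 * w\<^sup>2" using X Y Z by (simp add: D_def)
    have D_eq: "D = w * (A * w + B)"
    proof -
      have "D = (x\<^sup>2 + y\<^sup>2 + z\<^sup>2) - 2 * w * (x * X + y * Y + z * Z) + w\<^sup>2 * (X\<^sup>2 + Y\<^sup>2 + Z\<^sup>2)"
        by (simp add: D_def power2_eq_square algebra_simps)
      then show ?thesis unfolding eq[symmetric] by (simp add: A_def B_def power2_eq_square algebra_simps)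
    qed
    show ?case
    proof (cases "D = 0")
      case True
      then have "x = w * X" "y = w * Y" "z = w * Z"
        unfolding D_def by (simp_all add: add_nonneg_eq_0_iff)
      then have "n * w\<^sup>2 = (X\<^sup>2 + Y\<^sup>2 + Z\<^sup>2) * w\<^sup>2" using eq by (simp add: power_mult_distrib algebra_simps)
      then show ?thesis using w by auto
    next
      case False
      let ?w = "A * w + B"
      have "w * ?w > 0" using False \<open>D \<ge> 0\<close> unfolding D_eq[symmetric] by linarith
      then have "?w > 0" using w by (simp add: zero_less_mult_iff)
      have "w\<^sup>2 > 0" using w by simp
      then have "w * ?w < w * w" using D_le D_eq by (simp add: power2_eq_square)
      then have "?w < w" using w by simp
      have "n * ?w\<^sup>2 = A\<^sup>2 * (n * w\<^sup>2) + A * B * (2 * (n * w)) + B\<^sup>2 * n"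
        by (simp add: power2_eq_square algebra_simps)
      also have "\<dots> = A\<^sup>2 * (x\<^sup>2 + y\<^sup>2 + z\<^sup>2) + 2 * (A * B) * (x * X + y * Y + z * Z) + B\<^sup>2 * (X\<^sup>2 + Y\<^sup>2 + Z\<^sup>2)"
      proof -
        have "2 * (n * w) = B + 2 * (x * X + y * Y + z * Z)" "X\<^sup>2 + Y\<^sup>2 + Z\<^sup>2 = A + n"
          by (simp_all add: A_def B_def)
        then show ?thesis unfolding eq by (simp add: power2_eq_square algebra_simps)
      qed
      also have "\<dots> = (A * x + B * X)\<^sup>2 + (A * y + B * Y)\<^sup>2 + (A * z + B * Z)\<^sup>2"
        by (simp add: power2_eq_square algebra_simps)
      finally show ?thesis using less.hyps[of ?w] \<open>?w < w\<close> \<open>?w > 0\<close> w by auto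
    qed
  qed
  from this[of "\<bar>w\<bar>"] show ?thesis using assms by simp
qed

section \<open>The three-square theorem\<close>

lemma squarefree_nat_eq_prod:
  fixes n :: nat
  assumes "squarefree n"
  shows "n = \<Prod>(prime_factors n)"
proof -
  have "n \<noteq> 0" using assms by (metis not_squarefree_0)
  then have "n = (\<Prod>p\<in>prime_factors n. p ^ multiplicity p n)"
    by (simp add: prod_prime_factors)
  also have "\<dots> = \<Prod>(prime_factors n)"
    using squarefree_factorial_semiring'[OF \<open>n \<noteq> 0\<close>] assms by (intro prod.cong) auto
  finally show ?thesis .
qed

text \<open>The Chinese remainder theorem glues the roots modulo the primes, whose product is
  \<open>n\<close> by squarefreeness.\<close>

lemma squarefree_dvd_square_add:
  fixes n :: nat and c :: int
  assumes n: "squarefree n" and loc: "\<And>p. p \<in> prime_factors n \<Longrightarrow> \<exists>r. int p dvd r\<^sup>2 + c"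
  shows "\<exists>r. int n dvd r\<^sup>2 + c"
proof -
  have "\<forall>p\<in>prime_factors n. \<exists>u::nat. int p dvd (int u)\<^sup>2 + c"
  proof
    fix p assume p: "p \<in> prime_factors n"
    then obtain r where r: "int p dvd r\<^sup>2 + c" using loc by blast
    have "p > 0" using p prime_gt_0_nat by auto
    then have u: "int (nat (r mod int p)) = r mod int p" by simp
    have "[(r mod int p)\<^sup>2 + c = r\<^sup>2 + c] (mod int p)"
      by (intro cong_add cong_pow cong_refl) (simp add: cong_def)
    then show "\<exists>u::nat. int p dvd (int u)\<^sup>2 + c" using r u by (metis cong_dvd_iff)
  qed
  then obtain u :: "nat \<Rightarrow> nat" where u: "\<And>p. p \<in> prime_factors n \<Longrightarrow> int p dvd (int (u p))\<^sup>2 + c" by metis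
  have "\<exists>x. \<forall>p\<in>prime_factors n. [x = u p] (mod p)"
    by (intro chinese_remainder_nat) (auto intro: primes_coprime)
  then obtain x where x: "\<And>p. p \<in> prime_factors n \<Longrightarrow> [x = u p] (mod p)" by blast
  have dvd: "int p dvd (int x)\<^sup>2 + c" if "p \<in> prime_factors n" for p
  proof -
    have "[(int x)\<^sup>2 + c = (int (u p))\<^sup>2 + c] (mod int p)"
      using x[OF that] by (intro cong_add cong_pow cong_refl) (simp add: cong_int_iff)
    then show ?thesis using u[OF that] cong_dvd_iff by blast
  qed
  have "(\<Prod>p\<in>prime_factors n. int p) dvd (int x)\<^sup>2 + c"
    using cong_cong_prod_coprime[of "prime_factors n" "(int x)\<^sup>2 + c" 0 int] dvd
    by (auto simp: cong_0_iff intro: primes_coprime)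
  moreover have "(\<Prod>p\<in>prime_factors n. int p) = int n"
    using arg_cong[OF squarefree_nat_eq_prod[OF n], of int] by (simp only: of_nat_prod)
  ultimately show ?thesis by auto
qed

text \<open>As -1 is a square modulo \<open>q\<close>, Legendre's equation with \<open>Q = 1\<close>
  is solvable. A rational representation is enough, since the later descent clears
  denominators.\<close>

lemma sum_two_squares_multiple:
  assumes "q = 1 \<or> prime q" "q mod 4 = 1"
  shows "\<exists>e f g :: int. g \<noteq> 0 \<and> int q * g\<^sup>2 = e\<^sup>2 + f\<^sup>2"
proof (cases "q = 1")
  case True
  then show ?thesis by (intro exI[of _ 1] exI[of _ 0]) simp
next
  case False
  then have q: "prime q" using assms by simp
  then have "2 < q" using assms(2) prime_ge_2_nat[of q] by (cases "q = 2") auto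
  then have "Legendre (-1) (int q) = 1" using Legendre_minus_1_chi4[OF q] assms(2) by (simp add: chi4_def)
  then obtain r where "int q dvd r\<^sup>2 - (-1)" using Legendre_1_imp_dvd by blast
  then have "int q dvd r\<^sup>2 + int 1" by simp
  moreover have "q \<noteq> k\<^sup>2" for k using q by (auto simp: prime_power_iff)
  ultimately have "\<exists>z t w :: int. w \<noteq> 0 \<and> int q * w\<^sup>2 = z\<^sup>2 + int 1 * t\<^sup>2"
    using prime_gt_0_nat[OF q] by (intro legendre_equation_solvable[of q 1 r 0]) auto
  then show ?thesis by auto
qed

text \<open>Legendre's equation gives \<open>n * w\<^sup>2 = z\<^sup>2 + Q * t\<^sup>2\<close>, and
  the rational representation of \<open>Q\<close> splits the last term into two squares.\<close>

lemma sum_three_squares_if_Legendre: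
  fixes n Q :: nat
  assumes n: "squarefree n" "n > 1" and Q: "Q > 0" "coprime n Q"
    and r: "\<And>p. p \<in> prime_factors n \<Longrightarrow> \<exists>r. int p dvd r\<^sup>2 + int Q"
    and s: "int Q dvd s\<^sup>2 - int n"
    and Q2: "g \<noteq> 0" "int Q * g\<^sup>2 = e\<^sup>2 + f\<^sup>2"
  shows "\<exists>a b c :: int. int n = a\<^sup>2 + b\<^sup>2 + c\<^sup>2"
proof -
  obtain r where r: "int n dvd r\<^sup>2 + int Q" using squarefree_dvd_square_add[OF n(1)] r by blast
  have "n \<noteq> k\<^sup>2" for k
  proof
    assume k: "n = k\<^sup>2"
    then have "is_unit k" using n(1) by (auto simp: squarefree_def)
    then show False using k n(2) by simp
  qed
  then obtain z t w where w: "w \<noteq> 0" "int n * w\<^sup>2 = z\<^sup>2 + int Q * t\<^sup>2"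
    using legendre_equation_solvable[of n Q r s] n(2) Q r s by auto
  have "int n * (w * g)\<^sup>2 = (int n * w\<^sup>2) * g\<^sup>2" by (simp add: power_mult_distrib)
  also have "\<dots> = (z * g)\<^sup>2 + (int Q * g\<^sup>2) * t\<^sup>2" unfolding w(2) by (simp add: power_mult_distrib algebra_simps)
  also have "\<dots> = (z * g)\<^sup>2 + (e * t)\<^sup>2 + (f * t)\<^sup>2" unfolding Q2(2) by (simp add: power_mult_distrib algebra_simps)
  finally show ?thesis using rational_sum_three_squares w(1) Q2(1) by (metis mult_eq_0_iff)
qed

text \<open>The multiplier \<open>c\<close> is 2 exactly when \<open>n \<equiv> 3 (mod 8)\<close>. Reciprocity turns
  \<open>(n/q)\<close> into the product of \<open>(-c/p)\<close> over the odd primes \<open>p\<close> dividing \<open>n\<close>, and \<open>\<delta> = (2/q)\<close>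
  compensates for the sign of this product when \<open>n\<close> is even.\<close>
lemma squarefree_sum_three_squares:
  fixes n :: nat
  assumes n: "squarefree n" and mod8: "n mod 8 \<noteq> 7"
  shows "\<exists>a b c :: int. int n = a\<^sup>2 + b\<^sup>2 + c\<^sup>2"
proof (cases "n > 1")
  case False
  then have "n = 0 \<or> n = 1" by auto
  then have "int n = (int n)\<^sup>2 + 0\<^sup>2 + 0\<^sup>2" by auto
  then show ?thesis by blast
next
  case n1: True
  define P where "P = prime_factors n - {2}"
  define N where "N = \<Prod>P"
  define c :: nat where "c = (if n mod 8 = 3 then 2 else 1)"
  define \<delta> where "\<delta> = (if even n then chi4 N else 1)"
  have P: "finite P" "\<And>p. p \<in> P \<Longrightarrow> prime p" "\<And>p. p \<in> P \<Longrightarrow> 2 < p" "\<And>p. p \<in> P \<Longrightarrow> p dvd n"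
    unfolding P_def using prime_ge_2_nat by (auto simp: le_less)
  have n_N: "n = (if even n then 2 * N else N)"
  proof -
    have "n = \<Prod>(prime_factors n)" by (rule squarefree_nat_eq_prod[OF n])
    moreover have "2 \<in> prime_factors n \<longleftrightarrow> even n" using n1 by (auto simp: prime_factors_dvd)
    ultimately show ?thesis unfolding N_def P_def by (cases "even n") (auto simp: prod.remove)
  qed
  have "odd N"
  proof
    assume "even N"
    then obtain p where p: "p \<in> P" "2 dvd p" unfolding N_def using P(1) by (auto simp: prime_dvd_prod_iff)
    then show False using P(2,3)[OF p(1)] prime_odd_nat[of p] by simp
  qed
  then have chi4_N: "chi4 N \<in> {-1, 1}"
  proof -
    have "N mod 4 = 1 \<or> N mod 4 = 3" using \<open>odd N\<close> by presburger
    then show ?thesis by (auto simp: chi4_def)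
  qed
  then have \<delta>: "\<delta> \<in> {-1, 1}" by (simp add: \<delta>_def)
  have leg_nz: "Legendre (- int c) (int p) \<in> {-1, 1}" if "p \<in> P" for p
  proof -
    have "\<not> int p dvd - int c" using P(3)[OF that] by (auto simp: c_def dest!: zdvd_imp_le)
    then show ?thesis using Legendre_range[of "- int c" p] Legendre_eq_0_iff[of "- int c" p] by auto
  qed
  obtain q where q: "q = 1 \<or> prime q" "q mod 4 = 1" "chi8 q = \<delta>"
      "\<And>p. p \<in> P \<Longrightarrow> Legendre (int q) (int p) = Legendre (- int c) (int p)"
    using exists_prime_with_residues[of P "\<lambda>p. Legendre (- int c) (int p)" \<delta>] P leg_nz \<delta> by blast
  have "odd q" using q(2) by presburger
  have r: "\<exists>r. int p dvd r\<^sup>2 + int (c * q)" if p: "p \<in> prime_factors n" for p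
  proof (cases "p = 2")
    case True
    then have "c = 1" using p n1 by (auto simp: c_def prime_factors_dvd) presburger
    then show ?thesis using True \<open>odd q\<close> by (intro exI[of _ 1]) simp
  next
    case False
    then have pP: "p \<in> P" using p by (simp add: P_def)
    have "Legendre (- int c * int q) (int p) = 1"
      using leg_nz[OF pP] q(4)[OF pP] Legendre_mult[OF P(2,3)[OF pP], of "- int c" "int q"] by auto
    then obtain y where "int p dvd y\<^sup>2 - (- int c * int q)" using Legendre_1_imp_dvd by blast
    then show ?thesis by auto
  qed
  have cop_q: "coprime n q"
  proof (rule ccontr)
    assume "\<not> coprime n q"
    then have "prime q" "q dvd n" using q(1) prime_imp_coprime[of q n] by (auto simp: coprime_commute)
    then have "q \<in> P" using \<open>odd q\<close> n1 by (auto simp: P_def prime_factors_dvd)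
    then show False using q(4)[of q] leg_nz[of q] Legendre_eq_0_iff[of "int q" "int q"] by auto
  qed
  have cop: "coprime n (c * q)"
  proof -
    have "coprime n c" unfolding c_def by (cases "n mod 8 = 3") (simp_all, presburger)
    then show ?thesis using cop_q by simp
  qed
  have leg_n: "Legendre (int n) (int q) = 1" if "q \<noteq> 1"
  proof -
    have pq: "prime q" using q(1) that by simp
    have q2: "2 < q" using q(2) prime_ge_2_nat[OF pq] by (cases "q = 2") auto
    have flip: "Legendre (int p) (int q) = Legendre (- int c) (int p)" if p: "p \<in> P" for p
    proof -
      have "p \<noteq> q"
        using coprime_common_divisor[OF cop_q P(4)[OF p]] P(3)[OF p] by auto
      then have "Legendre p q * Legendre q p = (-1) ^ ((p - 1) div 2 * ((q - 1) div 2))"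
        using Quadratic_Reciprocity[OF P(2,3)[OF p] pq q2] by simp
      \<comment> \<open>This is where \<open>q mod 4 = 1\<close> enters: reciprocity carries no
        sign, whatever \<open>p\<close> is.\<close>
      moreover have "even ((q - 1) div 2)" using q(2) by presburger
      ultimately have "Legendre p q * Legendre q p = 1" by simp
      then show ?thesis using leg_nz[OF p] q(4)[OF p] by auto
    qed
    have "Legendre (int N) (int q) = (\<Prod>p\<in>P. Legendre (int p) (int q))"
      unfolding N_def using Legendre_prod[OF pq q2, of int P] by simp
    also have "\<dots> = (\<Prod>p\<in>P. Legendre (- int c) (int p))" using flip by (rule prod.cong[OF refl])
    also have "\<dots> = (\<Prod>p\<in>P. if c = 2 then chi4 p * chi8 p else chi4 p)"
    proof (rule prod.cong[OF refl])
      fix p assume p: "p \<in> P"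
      show "Legendre (- int c) (int p) = (if c = 2 then chi4 p * chi8 p else chi4 p)"
        using Legendre_minus_1_chi4[OF P(2,3)[OF p]] Legendre_2_chi8[OF P(2,3)[OF p]]
          Legendre_mult[OF P(2,3)[OF p], of "-1" 2] by (auto simp: c_def)
    qed
    also have "\<dots> = (if c = 2 then chi4 N * chi8 N else chi4 N)"
      by (simp add: N_def chi4_prod chi8_prod prod.distrib)
    finally have leg_N: "Legendre (int N) (int q) = (if c = 2 then chi4 N * chi8 N else chi4 N)" .
    show ?thesis
    proof (cases "even n")
      case True
      then have "n mod 8 \<noteq> 3" by presburger
      then have "Legendre (int N) (int q) = chi4 N" using leg_N by (simp add: c_def)
      moreover have "Legendre (int n) (int q) = Legendre 2 (int q) * Legendre (int N) (int q)"
        using n_N True Legendre_mult[OF pq q2, of 2 "int N"] by simp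
      ultimately show ?thesis
        using Legendre_2_chi8[OF pq q2] q(3) True chi4_N by (auto simp: \<delta>_def)
    next
      case False
      then have nN: "n = N" using n_N by simp
      \<comment> \<open>For residue 3 both \<open>chi4 N\<close> and \<open>chi8 N\<close> are -1
        and \<open>c = 2\<close> multiplies them; for 1 and 5, \<open>chi4 N = 1\<close> already
        suffices.\<close>
      have "n mod 8 = 1 \<or> n mod 8 = 3 \<or> n mod 8 = 5" using False mod8 by presburger
      then show ?thesis
      proof (elim disjE)
        assume "n mod 8 = 3"
        moreover from this have "n mod 4 = 3" by presburger
        ultimately show ?thesis using leg_N nN by (simp add: c_def chi4_def chi8_def)
      next
        assume "n mod 8 = 1"
        moreover from this have "n mod 4 = 1" by presburger
        ultimately show ?thesis using leg_N nN by (simp add: c_def chi4_def)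
      next
        assume "n mod 8 = 5"
        moreover from this have "n mod 4 = 1" by presburger
        ultimately show ?thesis using leg_N nN by (simp add: c_def chi4_def)
      qed
    qed
  qed
  obtain s where s: "int (c * q) dvd s\<^sup>2 - int n"
  proof -
    obtain s where s: "int q dvd s\<^sup>2 - int n"
      using leg_n Legendre_1_imp_dvd[of "int n" "int q"] by (cases "q = 1") auto
    show ?thesis
    proof (cases "c = 1")
      case True
      then show ?thesis using s that by simp
    next
      case False
      then have c: "c = 2" and "odd n" unfolding c_def by (auto split: if_splits) presburger
      \<comment> \<open>Adding the odd number \<open>q\<close> corrects the parity of the root
        without changing it modulo \<open>q\<close>.\<close>
      define s' where "s' = (if odd s then s else s + int q)"
      have "odd s'" using \<open>odd q\<close> by (auto simp: s'_def)
      have "(s + int q)\<^sup>2 - int n = (s\<^sup>2 - int n) + int q * (2 * s + int q)"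
        by (simp add: power2_eq_square algebra_simps)
      then have "int q dvd (s + int q)\<^sup>2 - int n" using s by (simp only: dvd_add dvd_triv_left)
      then have "int q dvd s'\<^sup>2 - int n" using s by (simp add: s'_def)
      moreover have "2 dvd s'\<^sup>2 - int n" using \<open>odd s'\<close> \<open>odd n\<close> by simp
      moreover have "coprime 2 (int q)" using \<open>odd q\<close> by simp
      ultimately have "2 * int q dvd s'\<^sup>2 - int n" by (intro divides_mult)
      then show ?thesis using that c by simp
    qed
  qed
  obtain e f g where g: "g \<noteq> 0" "int (c * q) * g\<^sup>2 = e\<^sup>2 + f\<^sup>2"
  proof -
    obtain e f g where g: "g \<noteq> 0" "int q * g\<^sup>2 = e\<^sup>2 + f\<^sup>2"
      using sum_two_squares_multiple[OF q(1,2)] by blast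
    show ?thesis
    proof (cases "c = 1")
      case True
      then show ?thesis using g that by simp
    next
      case False
      then have "c = 2" by (simp add: c_def split: if_splits)
      then have "int (c * q) * g\<^sup>2 = (e + f)\<^sup>2 + (e - f)\<^sup>2" using g(2) by (simp add: power2_eq_square algebra_simps)
      then show ?thesis using g(1) that by blast
    qed
  qed
  have "c * q > 0" using \<open>odd q\<close> by (auto simp: c_def intro!: Nat.gr0I)
  then show ?thesis using sum_three_squares_if_Legendre[OF n n1 _ cop r s g] by blast
qed

text \<open>Write \<open>n = m * k\<^sup>2\<close> with squarefree \<open>m\<close>. The odd part of
  \<open>k\<close> has square 1 modulo 8, so \<open>m mod 8 = 7\<close> would give \<open>n\<close>
  the excluded form.\<close>

theorem sum_three_squares:
  fixes n :: nat
  assumes "\<not> (\<exists>r s. n = 4 ^ r * (8 * s + 7))"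
  shows "\<exists>a b c :: int. int n = a\<^sup>2 + b\<^sup>2 + c\<^sup>2"
proof (cases "n = 0")
  case True
  then show ?thesis by (intro exI[of _ 0]) simp
next
  case False
  define m k where "m = squarefree_part n" and "k = square_part n"
  have n: "n = m * k\<^sup>2" unfolding m_def k_def by (rule squarefree_decompose)
  have "m mod 8 \<noteq> 7"
  proof
    assume m: "m mod 8 = 7"
    have "k > 0" using n False by (auto intro: Nat.gr0I)
    then obtain j where j: "k = 2 ^ multiplicity 2 k * j" "odd j"
      using multiplicity_decompose'[of k "2::nat"] by auto
    have "j mod 8 = 1 \<or> j mod 8 = 3 \<or> j mod 8 = 5 \<or> j mod 8 = 7" using j(2) by presburger
    moreover have "j\<^sup>2 mod 8 = (j mod 8)\<^sup>2 mod 8" by (simp add: power_mod)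
    ultimately have "j\<^sup>2 mod 8 = 1" by (elim disjE) simp_all
    then have "m * j\<^sup>2 mod 8 = 7" using m by (metis mod_mult_eq mult.right_neutral mod_mod_trivial)
    then have "m * j\<^sup>2 = 8 * (m * j\<^sup>2 div 8) + 7" by (metis mult_div_mod_eq)
    moreover have "n = 4 ^ multiplicity 2 k * (m * j\<^sup>2)"
    proof -
      have "k\<^sup>2 = 4 ^ multiplicity 2 k * j\<^sup>2"
        by (subst j(1)) (simp add: power_mult_distrib power2_eq_square flip: power_mult_distrib)
      then show ?thesis using n by simp
    qed
    ultimately show False using assms by metis
  qed
  moreover have "squarefree m" by (simp add: m_def)
  ultimately obtain a b c where "int m = a\<^sup>2 + b\<^sup>2 + c\<^sup>2"
    using squarefree_sum_three_squares by blast
  then have "int n = (a * int k)\<^sup>2 + (b * int k)\<^sup>2 + (c * int k)\<^sup>2"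
    by (simp add: n power_mult_distrib algebra_simps)
  then show ?thesis by blast
qed

section \<open>Factorization of integral quaternions\<close>

text \<open>In the exceptional case one square \<open>(2 ^ r)\<^sup>2\<close> is removed: the
  remaining factor \<open>8 * s + 6\<close> is even but not divisible by 4, hence not
  exceptional.\<close>

lemma sum_four_squares:
  fixes n :: nat
  shows "\<exists>p q r s :: int. int n = p\<^sup>2 + q\<^sup>2 + r\<^sup>2 + s\<^sup>2"
proof (cases "\<exists>r s. n = 4 ^ r * (8 * s + 7)")
  case False
  then obtain a b c where "int n = a\<^sup>2 + b\<^sup>2 + c\<^sup>2" using sum_three_squares by blast
  then have "int n = a\<^sup>2 + b\<^sup>2 + c\<^sup>2 + 0\<^sup>2" by simp
  then show ?thesis by blast
next
  case True
  then obtain r s where n: "n = 4 ^ r * (8 * s + 7)" by blast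
  have "8 * s + 6 \<noteq> 4 ^ i * (8 * j + 7)" for i j
  proof (cases i)
    case 0
    have "8 * s + 6 \<noteq> 8 * j + 7" by presburger
    then show ?thesis using 0 by simp
  next
    case (Suc i')
    have "8 * s + 6 \<noteq> 4 * x" for x by presburger
    then show ?thesis using Suc by (simp add: mult.assoc)
  qed
  then obtain a b c where abc: "int (8 * s + 6) = a\<^sup>2 + b\<^sup>2 + c\<^sup>2" using sum_three_squares by blast
  have "int n = (2 ^ r)\<^sup>2 * (1 + int (8 * s + 6))"
  proof -
    have "(4::int) ^ r = (2 ^ r)\<^sup>2"
      using power_mult[of "2::int" 2 r] power_mult[of "2::int" r 2] by (simp add: mult.commute)
    then show ?thesis by (simp add: n)
  qed
  also have "\<dots> = (2 ^ r)\<^sup>2 + (2 ^ r * a)\<^sup>2 + (2 ^ r * b)\<^sup>2 + (2 ^ r * c)\<^sup>2"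
    unfolding abc by (simp add: power_mult_distrib algebra_simps)
  finally show ?thesis by blast
qed

text \<open>A quaternion \<open>k + u i + v j + w k\<close> factors as \<open>conj \<alpha> * \<beta>\<close> with integral
  \<open>\<alpha> = (a, b, c, d)\<close> of norm \<open>l\<close> and \<open>\<beta> = (x, y, z, t)\<close> of norm \<open>m\<close>.\<close>
definition quat_factors :: "int \<Rightarrow> int \<Rightarrow> int \<Rightarrow> int \<Rightarrow> int \<Rightarrow> int \<Rightarrow> bool" where
  "quat_factors l m k u v w \<longleftrightarrow> (\<exists>a b c d x y z t.
     l = a\<^sup>2 + b\<^sup>2 + c\<^sup>2 + d\<^sup>2 \<and> m = x\<^sup>2 + y\<^sup>2 + z\<^sup>2 + t\<^sup>2 \<and>
     k = a * x + b * y + c * z + d * t \<and> u = a * y - b * x - c * t + d * z \<and>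
     v = a * z + b * t - c * x - d * y \<and> w = a * t - b * z + c * y - d * x)"

text \<open>Conjugation reverses products and negates the imaginary part.\<close>

lemma quat_factors_swap:
  assumes "quat_factors m l k (-u) (-v) (-w)"
  shows "quat_factors l m k u v w"
proof -
  obtain a b c d x y z t where eqs: "m = a\<^sup>2 + b\<^sup>2 + c\<^sup>2 + d\<^sup>2" "l = x\<^sup>2 + y\<^sup>2 + z\<^sup>2 + t\<^sup>2"
    "k = a * x + b * y + c * z + d * t" "- u = a * y - b * x - c * t + d * z"
    "- v = a * z + b * t - c * x - d * y" "- w = a * t - b * z + c * y - d * x"
    using assms unfolding quat_factors_def by blast
  have "k = x * a + y * b + z * c + t * d" "u = x * b - y * a - z * d + t * c"
    "v = x * c + y * d - z * a - t * b" "w = x * d - y * c + z * b - t * a"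
    using eqs(3-6) by (simp_all only: mult.commute[of x] mult.commute[of y] mult.commute[of z] mult.commute[of t])
  then show ?thesis unfolding quat_factors_def using eqs(1,2) by blast
qed

lemma quat_norm_mult:
  fixes a b c d x y z t :: int
  shows "(a\<^sup>2 + b\<^sup>2 + c\<^sup>2 + d\<^sup>2) * (x\<^sup>2 + y\<^sup>2 + z\<^sup>2 + t\<^sup>2) =
    (a * x + b * y + c * z + d * t)\<^sup>2 + (a * y - b * x - c * t + d * z)\<^sup>2 +
    (a * z + b * t - c * x - d * y)\<^sup>2 + (a * t - b * z + c * y - d * x)\<^sup>2"
  by (simp add: power2_eq_square algebra_simps)

text \<open>Replacing \<open>\<beta>\<close> by \<open>\<beta> + \<alpha> q\<close> adds \<open>l q\<close> to the product.\<close>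
lemma quat_factors_shift:
  assumes f: "quat_factors l m' (k - l * q0) (u - l * q1) (v - l * q2) (w - l * q3)"
    and l: "l > 0" and norm: "k\<^sup>2 + u\<^sup>2 + v\<^sup>2 + w\<^sup>2 = l * m"
  shows "quat_factors l m k u v w"
proof -
  obtain a b c d x y z t where eqs: "l = a\<^sup>2 + b\<^sup>2 + c\<^sup>2 + d\<^sup>2"
    "k - l * q0 = a * x + b * y + c * z + d * t" "u - l * q1 = a * y - b * x - c * t + d * z"
    "v - l * q2 = a * z + b * t - c * x - d * y" "w - l * q3 = a * t - b * z + c * y - d * x"
    using f unfolding quat_factors_def by blast
  define x' where "x' = x + (a * q0 - b * q1 - c * q2 - d * q3)"
  define y' where "y' = y + (a * q1 + b * q0 + c * q3 - d * q2)"
  define z' where "z' = z + (a * q2 - b * q3 + c * q0 + d * q1)"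
  define t' where "t' = t + (a * q3 + b * q2 - c * q1 + d * q0)"
  have prods: "k = a * x' + b * y' + c * z' + d * t'" "u = a * y' - b * x' - c * t' + d * z'"
    "v = a * z' + b * t' - c * x' - d * y'" "w = a * t' - b * z' + c * y' - d * x'"
  proof -
    let ?l = "a\<^sup>2 + b\<^sup>2 + c\<^sup>2 + d\<^sup>2"
    have "k = a * x + b * y + c * z + d * t + ?l * q0" "u = a * y - b * x - c * t + d * z + ?l * q1"
      "v = a * z + b * t - c * x - d * y + ?l * q2" "w = a * t - b * z + c * y - d * x + ?l * q3"
      unfolding eqs(1)[symmetric] using eqs(2-5) by linarith+
    then show "k = a * x' + b * y' + c * z' + d * t'" "u = a * y' - b * x' - c * t' + d * z'"
      "v = a * z' + b * t' - c * x' - d * y'" "w = a * t' - b * z' + c * y' - d * x'"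
      unfolding x'_def y'_def z'_def t'_def by (simp_all add: power2_eq_square algebra_simps)
  qed
  have "l * m = k\<^sup>2 + u\<^sup>2 + v\<^sup>2 + w\<^sup>2" by (rule norm[symmetric])
  also have "\<dots> = (a\<^sup>2 + b\<^sup>2 + c\<^sup>2 + d\<^sup>2) * (x'\<^sup>2 + y'\<^sup>2 + z'\<^sup>2 + t'\<^sup>2)"
    unfolding quat_norm_mult prods[symmetric] ..
  also have "a\<^sup>2 + b\<^sup>2 + c\<^sup>2 + d\<^sup>2 = l" by (rule eqs(1)[symmetric])
  finally have "m = x'\<^sup>2 + y'\<^sup>2 + z'\<^sup>2 + t'\<^sup>2" using l by simp
  then show ?thesis unfolding quat_factors_def using eqs(1) prods by blast
qed

text \<open>The one case in which reduction modulo \<open>l = 2 h\<close> gets stuck: with \<open>h = \<delta> * conj \<delta>\<close>,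
  \<open>h (1 + i + j + k) = ((1 + i) \<delta>) (conj \<delta> (1 + j))\<close>.\<close>
lemma quat_factors_stuck:
  assumes "h \<ge> 0"
  shows "quat_factors (2 * h) (2 * h) h h h h"
proof -
  obtain p q r s :: int where h: "h = p\<^sup>2 + q\<^sup>2 + r\<^sup>2 + s\<^sup>2"
    using sum_four_squares[of "nat h"] assms by auto
  show ?thesis unfolding quat_factors_def
    \<comment> \<open>With \<delta> = (p, q, r, s), the first four witnesses are the components of
      conj \<delta> * (1 - i), the conjugate of (1 + i) * \<delta>; the last four are those of conj
      \<delta> * (1 + j).\<close>
    by (rule exI[of _ "p - q"], rule exI[of _ "- p - q"], rule exI[of _ "s - r"], rule exI[of _ "- r - s"],
        rule exI[of _ "p + r"], rule exI[of _ "s - q"], rule exI[of _ "p - r"], rule exI[of _ "- q - s"])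
       (simp add: h power2_eq_square algebra_simps)
qed

text \<open>The strict lower bound excludes the residue -l/2, so that a residue of maximal size is
  l/2 and its sign is determined.\<close>

lemma balanced_residue:
  fixes x l :: int
  assumes "l > 0"
  obtains q where "- l < 2 * (x - l * q)" "2 * (x - l * q) \<le> l"
proof
  define q where "q = (2 * x + l - 1) div (2 * l)"
  define R where "R = (2 * x + l - 1) mod (2 * l)"
  have "2 * l * q + R = 2 * x + l - 1" unfolding q_def R_def by (rule mult_div_mod_eq)
  then have "2 * (x - l * q) = R - l + 1" by (simp add: algebra_simps)
  moreover have "0 \<le> R" "R < 2 * l" using assms by (auto simp: R_def)
  ultimately show "- l < 2 * (x - l * q)" "2 * (x - l * q) \<le> l" by linarith+
qed

text \<open>Balanced reduction modulo \<open>l\<close> leaves norm \<open>l * m'\<close> with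
  \<open>m' \<le> l\<close>. If \<open>m' < l\<close>, the norms are swapped and induction applies
  to \<open>m'\<close>; if \<open>m' = l\<close>, all four residues equal l/2, which is the stuck
  case.\<close>

lemma quat_factorization:
  assumes "l \<ge> 0" "m \<ge> 0" "k\<^sup>2 + u\<^sup>2 + v\<^sup>2 + w\<^sup>2 = l * m"
  shows "quat_factors l m k u v w"
  using assms
proof (induction "nat l" arbitrary: l m k u v w rule: less_induct)
  case less
  note norm = less.prems(3)
  show ?case
  proof (cases "l = 0")
    case True
    \<comment> \<open>All components vanish, so \<alpha> = 0 works with any \<beta> of norm
      \<open>m\<close>, supplied by the four-square theorem.\<close>
    then have sum0: "k\<^sup>2 + u\<^sup>2 + v\<^sup>2 + w\<^sup>2 = 0" using norm by simp
    have "k = 0" "u = 0" "v = 0" "w = 0"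
      using sum0 zero_le_power2[of k] zero_le_power2[of u] zero_le_power2[of v] zero_le_power2[of w]
      by (simp_all add: add_nonneg_eq_0_iff)
    moreover obtain x y z t :: int where "m = x\<^sup>2 + y\<^sup>2 + z\<^sup>2 + t\<^sup>2"
      using sum_four_squares[of "nat m"] less.prems(2) by auto
    ultimately show ?thesis unfolding quat_factors_def using True
      by (intro exI[of _ 0] exI[of _ x] exI[of _ y] exI[of _ z] exI[of _ t]) auto
  next
    case False
    then have l: "l > 0" using less.prems by simp
    obtain q0 where q0: "- l < 2 * (k - l * q0)" "2 * (k - l * q0) \<le> l" using balanced_residue[OF l] .
    obtain q1 where q1: "- l < 2 * (u - l * q1)" "2 * (u - l * q1) \<le> l" using balanced_residue[OF l] .
    obtain q2 where q2: "- l < 2 * (v - l * q2)" "2 * (v - l * q2) \<le> l" using balanced_residue[OF l] .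
    obtain q3 where q3: "- l < 2 * (w - l * q3)" "2 * (w - l * q3) \<le> l" using balanced_residue[OF l] .
    define k' u' v' w' where defs: "k' = k - l * q0" "u' = u - l * q1" "v' = v - l * q2" "w' = w - l * q3"
    define m' where "m' = m - 2 * (k * q0 + u * q1 + v * q2 + w * q3) + l * (q0\<^sup>2 + q1\<^sup>2 + q2\<^sup>2 + q3\<^sup>2)"
    have norm': "k'\<^sup>2 + u'\<^sup>2 + v'\<^sup>2 + w'\<^sup>2 = l * m'"
    proof -
      have "k'\<^sup>2 + u'\<^sup>2 + v'\<^sup>2 + w'\<^sup>2 = (k\<^sup>2 + u\<^sup>2 + v\<^sup>2 + w\<^sup>2)
          - 2 * l * (k * q0 + u * q1 + v * q2 + w * q3) + l\<^sup>2 * (q0\<^sup>2 + q1\<^sup>2 + q2\<^sup>2 + q3\<^sup>2)"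
        unfolding defs by (simp add: power2_eq_square algebra_simps)
      then show ?thesis unfolding norm m'_def by (simp add: power2_eq_square algebra_simps)
    qed
    then have "0 \<le> l * m'" by (metis add_nonneg_nonneg zero_le_power2)
    then have m'0: "0 \<le> m'" using l by (simp add: zero_le_mult_iff)
    have sq: "4 * e\<^sup>2 \<le> l\<^sup>2 \<and> (4 * e\<^sup>2 = l\<^sup>2 \<longrightarrow> 2 * e = l)" if "- l < 2 * e" "2 * e \<le> l" for e
    proof -
      have "(2 * e)\<^sup>2 \<le> l\<^sup>2" using that l by (subst abs_le_square_iff[symmetric]) auto
      moreover have "2 * e = l" if "(2 * e)\<^sup>2 = l\<^sup>2"
      proof -
        have "2 * e = l \<or> 2 * e = - l" using that by (simp only: power2_eq_iff)
        then show ?thesis using \<open>- l < 2 * e\<close> by linarith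
      qed
      ultimately show ?thesis by (simp add: power_mult_distrib)
    qed
    note sqs = sq[OF q0, folded defs] sq[OF q1, folded defs] sq[OF q2, folded defs] sq[OF q3, folded defs]
    have "4 * (l * m') \<le> 4 * l\<^sup>2" using sqs norm' by linarith
    then have "m' \<le> l" using l by (simp add: power2_eq_square)
    have "quat_factors l m' k' u' v' w'"
    proof (cases "m' < l")
      case True
      then have "quat_factors m' l k' (-u') (-v') (-w')"
        using less.hyps[of m' l k' "-u'" "-v'" "-w'"] norm' m'0 l by (simp add: mult.commute)
      then show ?thesis by (rule quat_factors_swap)
    next
      case False
      then have "m' = l" using \<open>m' \<le> l\<close> by simp
      then have "k'\<^sup>2 + u'\<^sup>2 + v'\<^sup>2 + w'\<^sup>2 = l\<^sup>2" using norm' by (simp add: power2_eq_square)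
      then have "4 * k'\<^sup>2 = l\<^sup>2" "4 * u'\<^sup>2 = l\<^sup>2" "4 * v'\<^sup>2 = l\<^sup>2" "4 * w'\<^sup>2 = l\<^sup>2"
        using sqs by linarith+
      then have "2 * k' = l" "2 * u' = l" "2 * v' = l" "2 * w' = l" using sqs by blast+
      then show ?thesis using quat_factors_stuck[of k'] \<open>m' = l\<close> l by auto
    qed
    then show ?thesis using quat_factors_shift l norm unfolding defs by blast
  qed
qed

section \<open>Deduction of the theorem\<close>

theorem theorem1:
  fixes m n l :: nat
  assumes "real n \<le> root 4 (real m * real l)"
    and "\<not> (\<exists>r s :: nat. int m * int l - int n ^ 4 = 4 ^ r * (8 * int s + 7))"
  shows "\<exists>a b c d :: nat. a\<^sup>2 + b\<^sup>2 + c\<^sup>2 + d\<^sup>2 = l \<and>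
    (\<exists>x y z t :: int. int m = x\<^sup>2 + y\<^sup>2 + z\<^sup>2 + t\<^sup>2 \<and>
      (int n)\<^sup>2 = int a * x + int b * y + int c * z + int d * t)"
proof -
  have "real n ^ 4 \<le> root 4 (real m * real l) ^ 4" using assms(1) by (intro power_mono) auto
  also have "\<dots> = real m * real l" by (rule real_root_pow_pos2) auto
  finally have le: "n ^ 4 \<le> m * l" by (simp flip: of_nat_mult of_nat_power)
  define D where "D = m * l - n ^ 4"
  have D: "int D = int m * int l - int n ^ 4" using le by (simp add: D_def of_nat_diff)
  have "\<not> (\<exists>r s. D = 4 ^ r * (8 * s + 7))"
  proof
    assume "\<exists>r s. D = 4 ^ r * (8 * s + 7)"
    then obtain r s where "D = 4 ^ r * (8 * s + 7)" by blast
    then have "int D = 4 ^ r * (8 * int s + 7)" by simp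
    then show False using assms(2) D by metis
  qed
  then obtain u v w where "int D = u\<^sup>2 + v\<^sup>2 + w\<^sup>2" using sum_three_squares by blast
  then have "((int n)\<^sup>2)\<^sup>2 + u\<^sup>2 + v\<^sup>2 + w\<^sup>2 = int l * int m"
    using D by (simp add: algebra_simps flip: power_mult)
  then have "quat_factors (int l) (int m) ((int n)\<^sup>2) u v w" by (intro quat_factorization) auto
  then obtain a b c d x y z t where abcd: "int l = a\<^sup>2 + b\<^sup>2 + c\<^sup>2 + d\<^sup>2"
    and xyzt: "int m = x\<^sup>2 + y\<^sup>2 + z\<^sup>2 + t\<^sup>2" "(int n)\<^sup>2 = a * x + b * y + c * z + d * t"
    unfolding quat_factors_def by blast
  \<comment> \<open>Signs of \<open>a\<close>, \<open>b\<close>, \<open>c\<close>, \<open>d\<close>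
    are moved into \<open>x\<close>, \<open>y\<close>, \<open>z\<close>, \<open>t\<close>. The value
    at 0 is 1, unlike that of \<open>sgn\<close>, so the squares of \<open>x\<close>,
    \<open>y\<close>, \<open>z\<close>, \<open>t\<close> are preserved.\<close>
  define sg where "sg = (\<lambda>e::int. if e < 0 then -1 else 1::int)"
  have sg: "(sg e * f)\<^sup>2 = f\<^sup>2" "int (nat \<bar>e\<bar>) * (sg e * f) = e * f" for e f by (auto simp: sg_def)
  show ?thesis
  proof (intro exI conjI)
    have "int ((nat \<bar>a\<bar>)\<^sup>2 + (nat \<bar>b\<bar>)\<^sup>2 + (nat \<bar>c\<bar>)\<^sup>2 + (nat \<bar>d\<bar>)\<^sup>2) = int l" by (simp add: abcd)
    then show "(nat \<bar>a\<bar>)\<^sup>2 + (nat \<bar>b\<bar>)\<^sup>2 + (nat \<bar>c\<bar>)\<^sup>2 + (nat \<bar>d\<bar>)\<^sup>2 = l" by (simp only: of_nat_eq_iff)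
    show "int m = (sg a * x)\<^sup>2 + (sg b * y)\<^sup>2 + (sg c * z)\<^sup>2 + (sg d * t)\<^sup>2" by (simp only: sg xyzt(1))
    show "(int n)\<^sup>2 = int (nat \<bar>a\<bar>) * (sg a * x) + int (nat \<bar>b\<bar>) * (sg b * y) + int (nat \<bar>c\<bar>) * (sg c * z) + int (nat \<bar>d\<bar>) * (sg d * t)"
      by (simp only: sg xyzt(2))
  qed
qed

end
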